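(* Let $h,m\in\mathbb{Z}^+$ with $m\ge2$ and $h\ge5$, and let $T=T(h,m)$ be the complete $m$-ary tree with height $h$. Then, for $k\in\mathbb{N}$, we have $\operatorname{M}^k(T)=\operatorname{M}^{k+2}(T)$ if and only if $k\ge\lceil\log_2 h\rceil$. In this range, the two graphs in the metamour limit set of $T$ are given by the edge criterion \[ xy\in E(\operatorname{M}^k(T)) \iff \left\lceil\log_2 d_{\operatorname{M}^2(T)}(x,y)\right\rceil\equiv k \pmod 2 \] for all distinct $x,y\in V(T)$, with the exception of the case where $x$ and $y$ both have depth $1$ with $m=2$ and $h\in\{5,6\}$; in that case, $xy$ is not an edge in either metamour limit graph.
   Context: $\mathbb{N}$ denotes the nonnegative integers. The complete $m$-ary tree $T(h,m)$ is the rooted tree with $h$ levels below the root in which every vertex of depth less than $h$ has exactly $m$ children; the depth of a vertex is its distance from the root. The metamour graph $\operatorname{M}(G)$ of a finite simple graph $G$ has vertex set $V(G)$, with $x,y$ adjacent iff $d_G(x,y)=2$ (graph distance); $\operatorname{M}^0(G)=G$, $\operatorname{M}^{k+1}(G)=\operatorname{M}(\operatorname{M}^k(G))$; equality is as labeled graphs. $G$ has metamour limit period $k\in\mathbb{Z}^+$ if there is $N\in\mathbb{N}$ with $\operatorname{M}^{k+i}(G)=\operatorname{M}^i(G)$ for all $i\ge N$, $k$ minimal; the metamour limit set is then $\{\operatorname{M}^i(G)\mid i\ge N\}$. If $x,y$ lie in different components of $\operatorname{M}^2(T)$, then $d_{\operatorname{M}^2(T)}(x,y)=\infty$ and the right-hand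 congruence in the edge criterion is regarded as false. *)

theory Defs
  imports
    Complex_Main
    "HOL-Number_Theory.Cong"
    "Graph_Theory.Graph_Theory"
begin

text \<open>
  Finite simple graphs are rendered by the locale \<open>pair_graph\<close> (finite, loop-free, symmetric, at most
  one arc for each ordered pair): an undirected edge \<open>xy\<close> is the pair of arcs \<open>(x, y)\<close>, \<open>(y, x)\<close>.
  Labelled graphs with the same vertices and edges are then equal as records.
\<close>

text \<open>With unit weights \<open>\<mu>\<close> is the least length of a walk, and \<open>\<infinity>\<close> across different components.\<close>

definition gdist :: "'a pair_pre_digraph \<Rightarrow> 'a \<Rightarrow> 'a \<Rightarrow> ereal" where
  "gdist G x y = wf_digraph.\<mu> (with_proj G) (\<lambda>_. 1) x y"

definition metamour :: "'a pair_pre_digraph \<Rightarrow> 'a pair_pre_digraph" where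
  "metamour G = \<lparr> pverts = pverts G,
     parcs = {(x, y). x \<in> pverts G \<and> y \<in> pverts G \<and> gdist G x y = 2} \<rparr>"

definition metamour_periodic_from :: "'a pair_pre_digraph \<Rightarrow> nat \<Rightarrow> nat \<Rightarrow> bool" where
  "metamour_periodic_from G k N \<longleftrightarrow>
     (\<forall>i\<ge>N. (metamour ^^ (k + i)) G = (metamour ^^ i) G)"

definition has_metamour_limit_period :: "'a pair_pre_digraph \<Rightarrow> nat \<Rightarrow> bool" where
  "has_metamour_limit_period G k \<longleftrightarrow>
     k > 0 \<and> (\<exists>N. metamour_periodic_from G k N) \<and>
     (\<forall>j. 0 < j \<and> j < k \<longrightarrow> \<not> (\<exists>N. metamour_periodic_from G j N))"

text \<open>
  Once the sequence is periodic from \<open>N\<close> on, the set of its members with index at least \<open>N\<close> does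
  not depend on \<open>N\<close>, so the union over all admissible \<open>N\<close> below is the set for any one of them.
\<close>

definition metamour_limit_set :: "'a pair_pre_digraph \<Rightarrow> 'a pair_pre_digraph set" where
  "metamour_limit_set G = {(metamour ^^ i) G | i k N.
     has_metamour_limit_period G k \<and> metamour_periodic_from G k N \<and> i \<ge> N}"

text \<open>
  Vertices are words of length at most \<open>h\<close> over \<open>{..<m}\<close>; the root is \<open>[]\<close>, and the children of
  \<open>v\<close> are the words \<open>i # v\<close> with \<open>i < m\<close>.
\<close>

definition complete_tree :: "nat \<Rightarrow> nat \<Rightarrow> nat list pair_pre_digraph" where
  "complete_tree h m =
     (let V = {v. set v \<subseteq> {..<m} \<and> length v \<le> h} in
      \<lparr> pverts = V,
        parcs = {(u, v). u \<in> V \<and> v \<in> V \<and> ((\<exists>i. v = i # u) \<or> (\<exists>i. u = i # v))} \<rparr>)"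

definition depth :: "nat list pair_pre_digraph \<Rightarrow> nat list \<Rightarrow> ereal" where
  "depth T v = gdist T [] v"

lemma pair_graph_complete_tree: "pair_graph (complete_tree h m)"
proof -
  let ?V = "{v. set v \<subseteq> {..<m} \<and> length v \<le> h}"
  have fin: "finite ?V"
    by (rule finite_lists_length_le) simp
  have "parcs (complete_tree h m) \<subseteq> ?V \<times> ?V"
    by (auto simp: complete_tree_def Let_def)
  then have "finite (parcs (complete_tree h m))"
    using fin by (meson finite_SigmaI finite_subset)
  then show ?thesis
    using fin
    by unfold_locales
      (auto simp: complete_tree_def Let_def symmetric_def sym_def)
qed

lemma gdist_commute_le:
  assumes "pair_graph G"
  shows "gdist G x y \<le> gdist G y x"
proof -
  interpret pair_graph G by fact
  have "\<mu> (\<lambda>_. 1) x y \<le> \<mu> (\<lambda>_. 1) y x"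
    unfolding \<mu>_def
  proof (rule INF_mono)
    fix p assume "p \<in> {p. awalk y p x}"
    then have "awalk x (rev_path p) y"
      by simp
    moreover have "awalk_cost (\<lambda>_. 1) (rev_path p) = awalk_cost (\<lambda>_. 1) p"
      by (induct p) (auto simp: awalk_cost_def)
    ultimately show "\<exists>q\<in>{p. awalk x p y}.
        ereal (awalk_cost (\<lambda>_. 1) q) \<le> ereal (awalk_cost (\<lambda>_. 1) p)"
      by (intro bexI[where x = "rev_path p"]) auto
  qed
  then show ?thesis
    by (simp add: gdist_def)
qed

lemma gdist_self:
  assumes "pair_graph G" "x \<in> pverts G"
  shows "gdist G x x \<le> 0"
proof -
  interpret pair_graph G by fact
  have "awalk x [] x"
    using assms(2) by (simp add: awalk_Nil_iff)
  from min_cost_le_walk_cost[OF this, of "\<lambda>_. 1"] show ?thesis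
    by (simp add: gdist_def zero_ereal_def)
qed

lemma pair_graph_metamour:
  assumes "pair_graph G"
  shows "pair_graph (metamour G)"
proof -
  interpret pair_graph G by fact
  have "parcs (metamour G) \<subseteq> pverts G \<times> pverts G"
    by (auto simp: metamour_def)
  then have "finite (parcs (metamour G))"
    using pair_finite_verts by (meson finite_SigmaI finite_subset)
  moreover have "gdist G x y = gdist G y x" for x y
    using gdist_commute_le[OF assms] by (simp add: order_antisym)
  then have "sym (parcs (metamour G))"
    by (auto simp: metamour_def sym_def)
  moreover have "gdist G x x \<noteq> 2" if "x \<in> pverts G" for x
    using gdist_self[OF assms that] by auto
  ultimately show ?thesis
    by unfold_locales (auto simp: metamour_def symmetric_def)
qed

end

theory Submission
  imports Defs "HOL-Library.Log_Nat"
begin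

text \<open>
  The sequence of metamour graphs of a graph sees distances only through their dyadic size. Let
  the level of a pair at distance \<open>n > 0\<close> be \<open>\<lceil>log 2 n\<rceil>\<close>. Roughly, the \<open>k\<close>-th metamour graph joins
  the pairs whose level is at most \<open>k\<close> and congruent to \<open>k\<close> modulo 2: in every step the pairs just
  joined are separated, while a pair of level \<open>c + 1\<close> is joined through a vertex that halves it
  into two pairs of level \<open>c\<close>. The midpoint of a shortest path does this for all distances but
  \<open>2 ^ c + 1\<close>, and pairs at distance 1 need a common vertex at distance 2. So the pattern holds in
  every graph in which certain common vertices exist, with some tolerance for pairs that lack them
  (\<open>dyadic_metamours\<close>).

  This is applied not to the tree \<open>T\<close> but to its second metamour graph. In \<open>T\<close> itself, being
  bipartite, the required vertices are missing; one sees directly that the first two metamour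
  graphs join the pairs at tree distance 2 and 4. Hence the distance in the second one is about a
  quarter of the tree distance (\<open>at_dist_E2_iff\<close>): exactly a quarter if 4 divides it, and
  otherwise, beyond tree distance 2, rounded up, because the walk can lose 2 by leaving the
  geodesic at one vertex. Pairs at tree distance 2 take two steps. Some pairs at tree distance 2
  or 6 lack the room for either, close to the lowest levels or around the root of a binary tree,
  and are at distance 3.

  Both for computing this distance and for finding the common vertices, one has to hang a vertex
  to a point of a geodesic by a path of prescribed length. Below the point this takes height,
  above it an ancestor, and at a fork a third child (\<open>branch_down\<close>, \<open>branch_up\<close>, \<open>branch_fork\<close>).
  Height 5 suffices throughout, with one exception: in a binary tree, a vertex at distance 2 from
  both vertices of depth 1 has depth 7. For heights 5 and 6 these two are therefore never joined
  from the second metamour graph on, and no other pair depends on them.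

  Finally, distances in the second metamour graph reach half the height, rounded up, so that the
  levels end at \<open>\<lceil>log 2 h\<rceil> - 1\<close>. As the graphs with indices \<open>k\<close> and \<open>k + 2\<close> differ by the pairs of
  level \<open>k\<close> if \<open>k \<ge> 2\<close>, they agree exactly from \<open>k = \<lceil>log 2 h\<rceil>\<close> on.
\<close>

section \<open>Distances in a graph and its metamour graph\<close>

definition at_dist :: "('a \<times> 'a) set \<Rightarrow> nat \<Rightarrow> 'a \<Rightarrow> 'a \<Rightarrow> bool" where
  "at_dist E n x y \<longleftrightarrow> (x, y) \<in> E ^^ n \<and> (\<forall>k<n. (x, y) \<notin> E ^^ k)"

lemma at_dist_unique: "at_dist E m x y \<Longrightarrow> at_dist E n x y \<Longrightarrow> m = n"
  unfolding at_dist_def by (metis linorder_neqE_nat)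

lemma at_dist_0_iff [simp]: "at_dist E 0 x y \<longleftrightarrow> x = y"
  by (simp add: at_dist_def)

lemma at_dist_1_iff: "at_dist E 1 x y \<longleftrightarrow> x \<noteq> y \<and> (x, y) \<in> E"
  by (auto simp: at_dist_def)

lemma relpow_imp_at_dist:
  assumes "(x, y) \<in> E ^^ n"
  obtains k where "k \<le> n" "at_dist E k x y"
proof
  let ?k = "LEAST k. (x, y) \<in> E ^^ k"
  show "?k \<le> n" using assms by (rule Least_le)
  show "at_dist E ?k x y"
    unfolding at_dist_def using assms LeastI[of "\<lambda>k. (x, y) \<in> E ^^ k"] not_less_Least by blast
qed

lemma at_dist_triangle:
  assumes "at_dist E a x z" "at_dist E b z y"
  obtains n where "n \<le> a + b" "at_dist E n x y"
proof -
  have "(x, y) \<in> E ^^ (a + b)"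
    using assms unfolding at_dist_def relpow_add by auto
  then show thesis by (rule relpow_imp_at_dist) (rule that)
qed

lemma at_dist_split:
  assumes "at_dist E (i + j) x y"
  obtains z where "at_dist E i x z" "at_dist E j z y"
proof -
  obtain z where z: "(x, z) \<in> E ^^ i" "(z, y) \<in> E ^^ j"
    using assms unfolding at_dist_def relpow_add by auto
  have *: "(x, y) \<in> E ^^ (a + b)" if "(x, z) \<in> E ^^ a" "(z, y) \<in> E ^^ b" for a b
    using that unfolding relpow_add by auto
  have le: "i + j \<le> a + b" if "(x, z) \<in> E ^^ a" "(z, y) \<in> E ^^ b" for a b
    using *[OF that] assms unfolding at_dist_def by (metis not_le)
  have "at_dist E i x z" "at_dist E j z y"
    unfolding at_dist_def using z le[of _ j] le[of i] by force+
  then show thesis by (rule that)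
qed

lemma awalk_length_iff_relpow:
  assumes "pair_graph G" "x \<in> pverts G"
  shows "(\<exists>p. pre_digraph.awalk (with_proj G) x p y \<and> length p = n) \<longleftrightarrow> (x, y) \<in> parcs G ^^ n"
proof -
  interpret pair_graph G by fact
  show ?thesis using assms(2)
  proof (induction n arbitrary: x)
    case 0
    then show ?case by (auto simp: awalk_Nil_iff)
  next
    case (Suc n)
    have "(\<exists>p. awalk x p y \<and> length p = Suc n) \<longleftrightarrow>
        (\<exists>z. (x, z) \<in> parcs G \<and> (\<exists>p. awalk z p y \<and> length p = n))"
      (is "?L \<longleftrightarrow> ?R")
    proof
      assume ?L
      then obtain p where p: "awalk x p y" "length p = Suc n" by blast
      then obtain e q where "p = e # q" "length q = n" by (auto simp: length_Suc_conv)
      with p show ?R by (cases e) (auto simp: awalk_Cons_iff)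
    next
      assume ?R
      then obtain z p where "(x, z) \<in> parcs G" "awalk z p y" "length p = n" by blast
      then show ?L by (intro exI[of _ "(x, z) # p"]) (auto simp: awalk_Cons_iff)
    qed
    also have "\<dots> \<longleftrightarrow> (\<exists>z. (x, z) \<in> parcs G \<and> (z, y) \<in> parcs G ^^ n)"
      by (intro ex_cong1 conj_cong refl Suc.IH) (auto dest: in_arcsD2)
    also have "\<dots> \<longleftrightarrow> (x, y) \<in> parcs G ^^ Suc n"
      by (blast dest: relpow_Suc_D2 intro: relpow_Suc_I2)
    finally show ?case .
  qed
qed

text \<open>
  Under unit weights the cost of a walk is its length, so the infimum defining the distance is
  attained by a shortest walk; it is \<open>\<infinity>\<close> precisely when there is no walk at all.
\<close>

lemma gdist_eq_of_at_dist:
  assumes "pair_graph G" "x \<in> pverts G" "at_dist (parcs G) n x y"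
  shows "gdist G x y = ereal (real n)"
proof -
  interpret pair_graph G by fact
  have cost: "awalk_cost (\<lambda>_. 1) p = real (length p)" for p :: "('a \<times> 'a) list"
    by (induct p) auto
  note walks = awalk_length_iff_relpow[OF assms(1,2)]
  obtain p where "awalk x p y" "length p = n"
    using assms(3) walks unfolding at_dist_def by blast
  moreover have "real n \<le> real (length q)" if "awalk x q y" for q
    using assms(3) walks that unfolding at_dist_def by (metis not_le of_nat_le_iff)
  ultimately show ?thesis
    unfolding gdist_def \<mu>_def by (intro INF_eqI) (auto simp: cost)
qed

lemma gdist_eq_infinity:
  assumes "pair_graph G" "x \<in> pverts G" "\<And>n. \<not> at_dist (parcs G) n x y"
  shows "gdist G x y = \<infinity>"
proof -
  interpret pair_graph G by fact
  have "\<not> awalk x p y" for p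
    using awalk_length_iff_relpow[OF assms(1,2)] assms(3) relpow_imp_at_dist by metis
  then show ?thesis by (simp add: gdist_def \<mu>_def top_ereal_def)
qed

lemma gdist_eq_iff_at_dist:
  assumes "pair_graph G" "x \<in> pverts G"
  shows "gdist G x y = ereal (real n) \<longleftrightarrow> at_dist (parcs G) n x y"
proof
  assume *: "gdist G x y = ereal (real n)"
  then obtain k where k: "at_dist (parcs G) k x y"
    using gdist_eq_infinity[OF assms] by (metis PInfty_neq_ereal(1))
  with * show "at_dist (parcs G) n x y"
    using gdist_eq_of_at_dist[OF assms k] by simp
qed (rule gdist_eq_of_at_dist[OF assms])

lemma pverts_metamour_funpow [simp]: "pverts ((metamour ^^ k) G) = pverts G"
  by (induct k) (auto simp: metamour_def)

lemma pair_graph_metamour_funpow: "pair_graph G \<Longrightarrow> pair_graph ((metamour ^^ k) G)"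
  by (induct k) (auto intro: pair_graph_metamour)

lemma metamour_arc_iff:
  assumes "pair_graph G"
  shows "(x, y) \<in> parcs (metamour G) \<longleftrightarrow>
    x \<noteq> y \<and> (x, y) \<notin> parcs G \<and> (\<exists>z. (x, z) \<in> parcs G \<and> (z, y) \<in> parcs G)"
proof -
  interpret pair_graph G by fact
  have "(x, y) \<in> parcs (metamour G) \<longleftrightarrow> x \<in> pverts G \<and> y \<in> pverts G \<and> at_dist (parcs G) 2 x y"
    using gdist_eq_iff_at_dist[OF assms, of x y 2] by (auto simp: metamour_def)
  also have "at_dist (parcs G) 2 x y \<longleftrightarrow>
      x \<noteq> y \<and> (x, y) \<notin> parcs G \<and> (\<exists>z. (x, z) \<in> parcs G \<and> (z, y) \<in> parcs G)"
    unfolding at_dist_def by (auto simp: numeral_2_eq_2 less_Suc_eq relcomp_unfold)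
  finally show ?thesis using in_arcsD1 in_arcsD2 by blast
qed

section \<open>Iterated metamour graphs and dyadic levels\<close>

text \<open>
  Call \<open>ceillog2 n\<close> the \<^emph>\<open>level\<close> of a pair at distance \<open>n > 0\<close> in \<open>G\<close>. Two pairs of level at most
  \<open>k\<close> that share a vertex span a distance of at most \<open>2 ^ Suc k\<close>, so the metamour step creates no
  level above \<open>Suc k\<close>; and the levels of the wrong parity disappear, because they were adjacent
  just before. The content is that every level of the right parity does appear.

  A pair of level \<open>Suc c\<close> gets a common neighbour by being halved into two pairs of level \<open>c\<close>, and
  a pair of level \<open>0\<close> by two pairs of level \<open>1\<close>, which is the hypothesis \<open>near\<close>. A midpoint of a
  shortest walk halves it correctly unless the distance is \<open>2 ^ c + 1\<close> with \<open>c \<ge> 1\<close>: the shorter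
  half is then \<open>2 ^ (c - 1)\<close>, one level too low. The hypothesis \<open>odd_dist\<close> asks for a common
  vertex off the shortest walks in that case.

  The relation \<open>X\<close> collects the pairs for which no such vertex exists. They stay nonadjacent
  forever: by \<open>X_parity\<close> no third vertex is ever adjacent to both ends. Their loss does not
  spread, because by \<open>X_bound\<close> no distance is as large as \<open>5\<close>, so no pair of level \<open>3\<close> has to be
  halved into pairs of level \<open>2\<close>, which is the level of the pairs in \<open>X\<close>.
\<close>

lemma dyadic_metamours:
  fixes G :: "'a pair_pre_digraph" and X :: "'a \<Rightarrow> 'a \<Rightarrow> bool"
  defines "D \<equiv> at_dist (parcs G)"
  assumes G: "pair_graph G"
    and near: "\<And>x y. D 1 x y \<Longrightarrow> \<exists>z. D 2 x z \<and> D 2 z y"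
    and odd_dist: "\<And>x y j. j \<ge> 1 \<Longrightarrow> D (2 ^ j + 1) x y \<Longrightarrow> \<not> X x y \<Longrightarrow>
      \<exists>z a b. D a x z \<and> D b z y \<and> a \<in> {2 ^ (j - 1) <.. 2 ^ j} \<and> b \<in> {2 ^ (j - 1) <.. 2 ^ j}"
    and X_dist: "\<And>x y. X x y \<Longrightarrow> D 3 x y"
    and X_parity: "\<And>x y z a b. X x y \<Longrightarrow> D a x z \<Longrightarrow> D b z y \<Longrightarrow> a > 0 \<Longrightarrow> b > 0 \<Longrightarrow>
      odd (ceillog2 a + ceillog2 b)"
    and X_bound: "\<And>x y u v n. X x y \<Longrightarrow> D n u v \<Longrightarrow> n \<le> 4"
  shows "(x, y) \<in> parcs ((metamour ^^ k) G) \<longleftrightarrow>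
    \<not> X x y \<and> (\<exists>n>0. D n x y \<and> ceillog2 n \<le> k \<and> even (ceillog2 n + k))"
proof (induction k arbitrary: x y)
  case 0
  interpret pair_graph G by fact
  have "(x, y) \<in> parcs G \<longleftrightarrow> D 1 x y"
    unfolding D_def at_dist_1_iff using no_loops'[of x] by auto
  moreover have "D 1 x y \<longleftrightarrow> \<not> X x y \<and> (\<exists>n>0. D n x y \<and> ceillog2 n \<le> 0)"
  proof -
    have "n = 1" if "n > 0" "ceillog2 n \<le> 0" for n
      using that ceillog2_le_iff[of n 0] by auto
    moreover have "ceillog2 1 \<le> 0" by simp
    moreover have "\<not> (D 1 x y \<and> X x y)"
      using X_dist[of x y] at_dist_unique[of "parcs G" 1 x y 3] by (auto simp: D_def)
    ultimately show ?thesis by (metis zero_less_one)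
  qed
  ultimately show ?case by auto
next
  case (Suc k)
  have cl3: "ceillog2 3 = 2" by (rule ceillog2_eqI) auto
  define C where "C c x y \<longleftrightarrow> (\<exists>n>0. D n x y \<and> ceillog2 n = c)" for c x y
  have X_C: "c = 2" if *: "X x y" "C c x y" for c x y
  proof -
    obtain n where "D n x y" "ceillog2 n = c" using *(2) unfolding C_def by blast
    moreover have "n = 3"
      using at_dist_unique[of "parcs G" n x y 3] X_dist[OF *(1)] calculation(1) by (simp add: D_def)
    ultimately show ?thesis using cl3 by simp
  qed
  have X_le: "c \<le> 2" if *: "X x y" "C c u v" for c x y u v
  proof -
    obtain n where "n > 0" "D n u v" "ceillog2 n = c" using *(2) unfolding C_def by blast
    with X_bound[OF *(1), of n u v] ceillog2_le_iff[of n 2] show ?thesis by simp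
  qed
  have C_unique: "c = d" if "C c x y" "C d x y" for c d x y
    using that at_dist_unique[of "parcs G"] unfolding C_def D_def by blast
  have IH: "(x, y) \<in> parcs ((metamour ^^ k) G) \<longleftrightarrow> \<not> X x y \<and> (\<exists>c\<le>k. C c x y \<and> even (c + k))" for x y
    unfolding Suc.IH C_def by auto
  \<comment> \<open>Only the lack of a suitable halving vertex can stop a level from appearing.\<close>
  have halve: "\<exists>z. C c x z \<and> C c z y" if xy: "C (Suc c) x y" "\<not> X x y" for c x y
  proof -
    obtain n where n: "n > 0" "D n x y" "ceillog2 n = Suc c" using xy(1) unfolding C_def by blast
    have hi: "n \<le> 2 ^ Suc c" using n ceillog2_le_iff[of n "Suc c"] by simp
    have lo: "2 ^ c < n" using n ceillog2_le_iff[of n c] by simp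
    have CI: "C c u v" if "D a u v" "2 ^ c < 2 * a" "a \<le> 2 ^ c" for a u v
      using that unfolding C_def by (intro exI[of _ a] conjI ceillog2_eqI) auto
    \<comment> \<open>\<open>c = 0\<close> is harmless: distance 2 splits into 1 and 1, both of level 0.\<close>
    show ?thesis
    proof (cases "c \<ge> 1 \<and> n = 2 ^ c + 1")
      case True
      then obtain z a b where z: "D a x z" "D b z y"
        "a \<in> {2 ^ (c - 1) <.. 2 ^ c}" "b \<in> {2 ^ (c - 1) <.. 2 ^ c}"
        using odd_dist[of c x y] n xy(2) by blast
      have "(2::nat) ^ c = 2 * 2 ^ (c - 1)" using True by (cases c) auto
      then show ?thesis using z by (intro exI[of _ z] conjI CI[of a] CI[of b]) auto
    next
      case False
      have e: "n div 2 + (n - n div 2) = n" by simp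
      obtain z where z: "D (n div 2) x z" "D (n - n div 2) z y"
        using at_dist_split[of "parcs G" "n div 2" "n - n div 2" x y] n(2) unfolding D_def e by metis
      have "2 ^ c < 2 * (n div 2)"
      proof (cases c)
        case 0
        then have "n = 2" using lo hi by simp
        then show ?thesis using 0 by simp
      next
        case (Suc c')
        then have "n \<ge> 2 * 2 ^ c' + 2" using False lo by auto
        moreover have "q + 1 \<le> n div 2" if "2 * q + 2 \<le> n" for q using that by linarith
        ultimately have "2 ^ c' + 1 \<le> n div 2" by blast
        then show ?thesis using Suc by simp
      qed
      moreover have "n - n div 2 \<le> 2 ^ c" using hi by simp
      ultimately show ?thesis using z by (intro exI[of _ z] conjI CI[of "n div 2"] CI[of "n - n div 2"]) auto
    qed
  qed
  have "(x, y) \<in> parcs ((metamour ^^ Suc k) G) \<longleftrightarrow>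
      x \<noteq> y \<and> (x, y) \<notin> parcs ((metamour ^^ k) G) \<and>
      (\<exists>z. (x, z) \<in> parcs ((metamour ^^ k) G) \<and> (z, y) \<in> parcs ((metamour ^^ k) G))"
    using metamour_arc_iff[OF pair_graph_metamour_funpow[OF G], of x y k] by simp
  also have "\<dots> \<longleftrightarrow> \<not> X x y \<and> (\<exists>c\<le>Suc k. C c x y \<and> even (c + Suc k))"
  proof safe
    fix z assume neq: "x \<noteq> y" and non: "(x, y) \<notin> parcs ((metamour ^^ k) G)"
      and "(x, z) \<in> parcs ((metamour ^^ k) G)" "(z, y) \<in> parcs ((metamour ^^ k) G)"
    then obtain a b where ab: "a > 0" "b > 0" "D a x z" "D b z y"
      "ceillog2 a \<le> k" "ceillog2 b \<le> k" "even (ceillog2 a + k)" "even (ceillog2 b + k)"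
      unfolding Suc.IH by blast
    obtain n where n: "n \<le> a + b" "D n x y"
      using at_dist_triangle ab(3,4) unfolding D_def by metis
    have "n > 0" using n neq by (cases n) (auto simp: D_def)
    {
      assume "X x y"
      from X_parity[OF this ab(3,4,1,2)] ab(7,8) show False by presburger
    }
    note notX = this
    have "a \<le> 2 ^ k" "b \<le> 2 ^ k" using ab by (simp_all add: ceillog2_le_iff)
    then have "ceillog2 n \<le> Suc k" using n \<open>n > 0\<close> by (simp add: ceillog2_le_iff)
    moreover have "C (ceillog2 n) x y" using n \<open>n > 0\<close> unfolding C_def by blast
    moreover from this have "even (ceillog2 n + Suc k)"
      using non notX \<open>ceillog2 n \<le> Suc k\<close> unfolding IH
      by (cases "ceillog2 n = Suc k") (auto simp: le_Suc_eq)
    ultimately show "\<exists>c\<le>Suc k. C c x y \<and> even (c + Suc k)" by blast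
  next
    fix c assume c: "c \<le> Suc k" "C c x y" "even (c + Suc k)" and nX: "\<not> X x y"
    {
      assume "(x, y) \<in> parcs ((metamour ^^ k) G)"
      then obtain d where "C d x y" "even (d + k)" unfolding IH by blast
      with c C_unique[of c x y d] show False by simp
    }
    show "\<exists>z. (x, z) \<in> parcs ((metamour ^^ k) G) \<and> (z, y) \<in> parcs ((metamour ^^ k) G)"
    proof (cases c)
      case 0
      then obtain n where n: "n > 0" "D n x y" "ceillog2 n = 0" using c(2) unfolding C_def by blast
      then have "n = 1" using ceillog2_le_iff[of n 0] by auto
      with n(2) obtain z where z: "D 2 x z" "D 2 z y" using near[of x y] by auto
      have C1: "C 1 u v" if "D 2 u v" for u v
        unfolding C_def using that by (intro exI[of _ 2]) simp
      have "C 1 x z" "C 1 z y" using z C1 by auto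
      moreover have "\<not> X x z" "\<not> X z y" using X_C[of _ _ 1] calculation by auto
      moreover have "1 \<le> k" "even (1 + k)" using c(3) 0 by (cases k; simp)+
      ultimately show ?thesis unfolding IH by blast
    next
      case (Suc c')
      then obtain z where z: "C c' x z" "C c' z y" using halve c(2) nX by blast
      have "\<not> X u v" if "C c' u v" for u v
      proof
        assume "X u v"
        from X_C[OF this that] X_le[OF this c(2)] Suc show False by simp
      qed
      then show ?thesis unfolding IH using z c Suc by auto
    qed
  next
    fix c assume "C c y y"
    then show False
      using at_dist_unique[of "parcs G" _ y y 0] unfolding C_def D_def by force
  qed
  finally show ?case unfolding C_def by auto
qed

section \<open>Dyadic logarithms and sequences of period two\<close>

lemma ceiling_log2_eq_ceillog2:
  assumes "n > 0"
  shows "\<lceil>log 2 (real n)\<rceil> = int (ceillog2 n)"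
proof -
  have "0 \<le> log 2 (real n)" using assms by simp
  then have "0 \<le> \<lceil>log 2 (real n)\<rceil>" by linarith
  then show ?thesis using assms by (simp add: ceillog2_def)
qed

lemma ceiling_log2_le_iff: "n > 0 \<Longrightarrow> \<lceil>log 2 (real n)\<rceil> \<le> int k \<longleftrightarrow> n \<le> 2 ^ k"
  by (simp add: ceiling_log2_eq_ceillog2 ceillog2_le_iff)

text \<open>
  A sequence that repeats after two steps takes, from some index on, one value at the even and one
  at the odd indices.
\<close>

lemma two_step_periodic:
  fixes f :: "nat \<Rightarrow> 'a"
  assumes step: "\<And>i. N \<le> i \<Longrightarrow> f (i + 2) = f i" and "N \<le> i" "N \<le> j" "even (i + j)"
  shows "f i = f j"
proof -
  have add: "f (i + 2 * d) = f i" if "N \<le> i" for i d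
  proof (induct d)
    case (Suc d)
    have "f (i + 2 * d + 2) = f (i + 2 * d)" using that by (intro step) simp
    with Suc show ?case by (simp add: add.assoc)
  qed simp
  have "j = i + 2 * ((j - i) div 2) \<or> i = j + 2 * ((i - j) div 2)" using assms(4) by presburger
  then show ?thesis using add assms(2,3) by metis
qed

section \<open>The metric of a tree and its branches\<close>

text \<open>
  Reading a vertex of the tree from the root, the two ends of a geodesic first share a common
  prefix and then part; what remains of both words is the geodesic. The vertices of the tree carry
  the child letter at the front, hence the reversals in \<open>tdist\<close>.
\<close>

fun word_dist :: "'a list \<Rightarrow> 'a list \<Rightarrow> nat" where
  "word_dist (a # u) (b # v) = (if a = b then word_dist u v else length u + length v + 2)"
| "word_dist [] v = length v"
| "word_dist u [] = length u"

definition tdist :: "'a list \<Rightarrow> 'a list \<Rightarrow> nat" where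
  "tdist x y = word_dist (rev x) (rev y)"

text \<open>
  Below a common ancestor, the words \<open>u\<close> and \<open>v\<close> lead into different subtrees (or one stays at the
  ancestor), so that the ancestor is the lowest common one.
\<close>

definition diverge :: "'a list \<Rightarrow> 'a list \<Rightarrow> bool" where
  "diverge u v \<longleftrightarrow> u = [] \<or> v = [] \<or> last u \<noteq> last v"

lemma word_dist_Nil2 [simp]: "word_dist u [] = length u"
  by (cases u) auto

lemma word_dist_append [simp]: "word_dist (z @ u) (z @ v) = word_dist u v"
  by (induct z) auto

lemma word_dist_commute: "word_dist u v = word_dist v u"
  by (induct u v rule: word_dist.induct) auto

lemma word_dist_eq_0_iff: "word_dist u v = 0 \<longleftrightarrow> u = v"
  by (induct u v rule: word_dist.induct) auto

lemma word_dist_le: "word_dist u v \<le> length u + length v"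
  by (induct u v rule: word_dist.induct) auto

lemma length_le_word_dist: "length u \<le> length v + word_dist u v"
  by (induct u v rule: word_dist.induct) auto

lemma word_dist_parity: "even (word_dist u v + length u + length v)"
  by (induct u v rule: word_dist.induct) auto

lemma word_dist_triangle: "word_dist u v \<le> word_dist u w + word_dist w v"
proof (induct u v arbitrary: w rule: word_dist.induct)
  case (1 a u b v)
  show ?case
  proof (cases w)
    case Nil
    then show ?thesis using word_dist_le[of u v] by simp
  next
    case (Cons c w')
    show ?thesis
      using 1[of w'] word_dist_le[of u v] length_le_word_dist[of u w'] length_le_word_dist[of v w']
        word_dist_commute[of v w'] word_dist_commute[of u w']
      by (auto simp: Cons)
  qed
next
  case (2 v)
  then show ?case using length_le_word_dist[of v w] word_dist_commute[of v w] by simp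
next
  case (3 a u)
  then show ?case using length_le_word_dist[of "a # u" w] by (simp add: add.commute)
qed

lemma tdist_commute: "tdist x y = tdist y x"
  by (simp add: tdist_def word_dist_commute)

lemma tdist_eq_0_iff [simp]: "tdist x y = 0 \<longleftrightarrow> x = y"
  by (simp add: tdist_def word_dist_eq_0_iff)

lemma tdist_self [simp]: "tdist x x = 0"
  by simp

lemma tdist_triangle: "tdist x y \<le> tdist x z + tdist z y"
  by (simp add: tdist_def word_dist_triangle)

lemma tdist_parity: "even (tdist x y + length x + length y)"
  using word_dist_parity[of "rev x" "rev y"] by (simp add: tdist_def)

lemma tdist_le: "tdist x y \<le> length x + length y"
  using word_dist_le[of "rev x" "rev y"] by (simp add: tdist_def)

lemma length_le_tdist: "length x \<le> length y + tdist x y"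
  using length_le_word_dist[of "rev x" "rev y"] by (simp add: tdist_def)

lemma tdist_diverge:
  assumes "diverge u v"
  shows "tdist (u @ z) (v @ z) = length u + length v"
  using assms word_dist_append[of "rev z" "[]"] word_dist_append[of "rev z" _ "[]"]
    word_dist_eq_0_iff[of "rev z" "rev z"]
  unfolding tdist_def diverge_def
  by (cases u rule: rev_cases; cases v rule: rev_cases) auto

lemma fork_cases:
  obtains u v z where "x = u @ z" "y = v @ z" "diverge u v" "tdist x y = length u + length v"
proof -
  have "\<exists>u v z. x = u @ z \<and> y = v @ z \<and> diverge u v"
  proof (induct x arbitrary: y rule: rev_induct)
    case Nil
    show ?case by (rule exI[of _ "[]"], rule exI[of _ y], rule exI[of _ "[]"]) (simp add: diverge_def)
  next
    case (snoc a x)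
    show ?case
    proof (cases "diverge (x @ [a]) y")
      case True
      then show ?thesis by (intro exI[of _ "x @ [a]"] exI[of _ y] exI[of _ "[]"]) simp
    next
      case False
      then obtain y' where y': "y = y' @ [a]" by (cases y rule: rev_cases) (auto simp: diverge_def)
      obtain u v z where "x = u @ z \<and> y' = v @ z \<and> diverge u v" using snoc by blast
      then show ?thesis by (intro exI[of _ u] exI[of _ v] exI[of _ "z @ [a]"]) (simp add: y')
    qed
  qed
  then show thesis using that tdist_diverge by blast
qed

lemma tdist_eq_1_iff: "tdist x y = 1 \<longleftrightarrow> (\<exists>i. y = i # x) \<or> (\<exists>i. x = i # y)"
proof
  assume *: "tdist x y = 1"
  obtain u v z where "x = u @ z" "y = v @ z" "tdist x y = length u + length v"
    by (rule fork_cases)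
  with * show "(\<exists>i. y = i # x) \<or> (\<exists>i. x = i # y)"
    by (cases u; cases v) auto
next
  have "tdist x (i # x) = 1" for i and x :: "'a list"
    using tdist_diverge[of "[]" "[i]" x] by (simp add: diverge_def)
  then show "(\<exists>i. y = i # x) \<or> (\<exists>i. x = i # y) \<Longrightarrow> tdist x y = 1"
    using tdist_commute by metis
qed

definition words :: "nat \<Rightarrow> nat \<Rightarrow> nat list set" where
  "words h m = {v. set v \<subseteq> {..<m} \<and> length v \<le> h}"

lemma pverts_complete_tree [simp]: "pverts (complete_tree h m) = words h m"
  by (simp add: complete_tree_def words_def Let_def)

lemma arc_complete_tree_iff:
  "(x, y) \<in> parcs (complete_tree h m) \<longleftrightarrow> x \<in> words h m \<and> y \<in> words h m \<and> tdist x y = 1"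
  unfolding tdist_eq_1_iff by (simp add: complete_tree_def words_def Let_def)

lemma other_letter:
  fixes c m :: nat
  assumes "m \<ge> 2"
  shows "\<exists>s<m. s \<noteq> c"
  using assms by (intro exI[of _ "if c = 0 then 1 else 0"]) auto

text \<open>
  Everything below reduces to the question which distances a third vertex can have to two given
  ones. A vertex \<open>w\<close> is hung by a path of length \<open>l\<close> to the point of the geodesic at distance \<open>i\<close>
  from \<open>x\<close> and \<open>j\<close> from \<open>y\<close>. The three lemmas differ by the position of that point and the
  direction of the path, and in what they demand: here the point lies strictly below the lowest
  common ancestor on the side of \<open>x\<close> (this is what \<open>i + length y < j + length x\<close> says), and the
  only need is enough height below it, as one of the at least two child letters is off the
  geodesic.
\<close>

lemma branch_down:
  assumes "x \<in> words h m" "y \<in> words h m" "m \<ge> 2"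
    and "i + j = tdist x y" "i + length y < j + length x" "length x + l \<le> h + i"
  shows "\<exists>w\<in>words h m. tdist x w = i + l \<and> tdist w y = j + l \<and> length w + i = length x + l"
proof -
  obtain u v z where uvz: "x = u @ z" "y = v @ z" "diverge u v" "tdist x y = length u + length v"
    by (rule fork_cases)
  then have i: "i < length u" using assms(4,5) by simp
  obtain s where s: "s < m" "s \<noteq> u ! (i - 1)"
    using other_letter[OF assms(3)] by blast
  define w where "w = replicate l s @ drop i u @ z"
  have len: "length w + i = length x + l" using i uvz(1) by (simp add: w_def)
  have "set (drop i u) \<subseteq> set u" by (rule set_drop_subset)
  then have "w \<in> words h m"
    using assms(1,6) s(1) len uvz(1) unfolding words_def w_def by auto
  moreover have "tdist x w = i + l"
  proof -
    have "diverge (take i u) (replicate l s)"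
      using s(2) i by (auto simp: diverge_def last_conv_nth min_def)
    from tdist_diverge[OF this, of "drop i u @ z"] show ?thesis
      using i append_take_drop_id[of i u] by (simp add: uvz(1) w_def flip: append_assoc)
  qed
  moreover have "tdist w y = j + l"
  proof -
    have "diverge (replicate l s @ drop i u) v"
      using uvz(3) i by (auto simp: diverge_def)
    from tdist_diverge[OF this, of z] show ?thesis
      using i assms(4) uvz(4) by (simp add: uvz(2) w_def)
  qed
  ultimately show ?thesis using len by blast
qed

lemma branch_down':
  assumes "x \<in> words h m" "y \<in> words h m" "m \<ge> 2"
    and "i + j = tdist x y" "j + length x < i + length y" "length y + l \<le> h + j"
  shows "\<exists>w\<in>words h m. tdist x w = i + l \<and> tdist w y = j + l \<and> length w + j = length y + l"
proof -
  have "j + i = tdist y x" using assms(4) by (simp add: tdist_commute)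
  from branch_down[OF assms(2,1,3) this assms(5,6)] show ?thesis by (auto simp: tdist_commute)
qed

text \<open>
  The equation \<open>i + length y = j + length x\<close> singles out the point of the geodesic that is the
  lowest common ancestor.
\<close>

lemma level_fork:
  assumes "i + j = tdist x y" "i + length y = j + length x"
  obtains u v z where "x = u @ z" "y = v @ z" "diverge u v" "length u = i" "length v = j"
proof -
  obtain u v z where *: "x = u @ z" "y = v @ z" "diverge u v" "tdist x y = length u + length v"
    by (rule fork_cases)
  then have "length u = i" "length v = j" using assms by simp_all
  with * show thesis by (intro that)
qed

text \<open>
  From the lowest common ancestor the path climbs \<open>r\<close> levels and descends into another subtree.
  This is available at any height, provided that the ancestor is not the root.
\<close>

lemma branch_up:
  assumes "x \<in> words h m" "y \<in> words h m" "m \<ge> 2"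
    and "i + j = tdist x y" "i + length y = j + length x"
    and "1 \<le> r" "r \<le> l" "i + r \<le> length x" "length x + l \<le> h + i + 2 * r"
  shows "\<exists>w\<in>words h m. tdist x w = i + l \<and> tdist w y = j + l \<and> length w + i + 2 * r = length x + l"
proof -
  obtain u v z where uvz: "x = u @ z" "y = v @ z" "diverge u v" "length u = i" "length v = j"
    using assms(4,5) by (rule level_fork)
  have r: "r \<le> length z" using assms(8) uvz by simp
  obtain s where s: "s < m" "s \<noteq> z ! (r - 1)"
    using other_letter[OF assms(3)] by blast
  define w where "w = replicate (l - r) s @ drop r z"
  have len: "length w + i + 2 * r = length x + l" using r assms(7) uvz(1,4) by (simp add: w_def)
  have "set (drop r z) \<subseteq> set z" by (rule set_drop_subset)
  then have "w \<in> words h m"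
    using assms(1,9) s(1) len uvz(1) unfolding words_def w_def by auto
  moreover
  have div: "diverge (q @ take r z) (replicate (l - r) s)" for q
  proof -
    have "last (take r z) = z ! (r - 1)" "take r z \<noteq> []"
      using r assms(6) by (cases "z = []"; simp add: last_conv_nth min.absorb2)+
    then show ?thesis using s(2) by (auto simp: diverge_def last_conv_nth[of "replicate _ _"])
  qed
  have dist: "tdist (q @ z) w = length q + l" for q
    using tdist_diverge[OF div, of q "drop r z"] r assms(7) append_take_drop_id[of r z]
    by (simp add: w_def)
  ultimately show ?thesis
    using len dist[of u] dist[of v] uvz
    by (intro bexI[of _ w]) (simp_all add: tdist_commute)
qed

text \<open>
  At the lowest common ancestor itself the geodesic may occupy two child letters, so a third one
  is needed. A binary tree has none, and \<open>branch_up\<close> is of no help if that ancestor is the root: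
  this is the source of all irregularities of binary trees.
\<close>

lemma branch_fork:
  assumes "x \<in> words h m" "y \<in> words h m" "m \<ge> 2"
    and "i + j = tdist x y" "i + length y = j + length x"
    and "length x + l \<le> h + i" "m \<ge> 3 \<or> i = 0 \<or> j = 0 \<or> l = 0"
  shows "\<exists>w\<in>words h m. tdist x w = i + l \<and> tdist w y = j + l \<and> length w + i = length x + l"
proof -
  obtain u v z where uvz: "x = u @ z" "y = v @ z" "diverge u v" "length u = i" "length v = j"
    using assms(4,5) by (rule level_fork)
  define A where "A = (if u = [] then {} else {last u}) \<union> (if v = [] then {} else {last v})"
  have "\<exists>s<m. l = 0 \<or> s \<notin> A"
  proof (cases "l = 0")
    case True
    then show ?thesis using assms(3) by (intro exI[of _ 0]) simp
  next
    case False
    have "card A < m"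
    proof (cases "u = [] \<or> v = []")
      case True
      then have "card A \<le> 1" unfolding A_def by auto
      then show ?thesis using assms(3) by simp
    next
      case F: False
      then have "m \<ge> 3" using assms(7) uvz(4,5) False by auto
      moreover have "card A \<le> 2" unfolding A_def using F by (simp add: card_insert_if)
      ultimately show ?thesis by simp
    qed
    moreover have "finite A" unfolding A_def by simp
    ultimately have "\<not> {..<m} \<subseteq> A" using card_mono[of A "{..<m}"] by auto
    then show ?thesis by auto
  qed
  then obtain s where s: "s < m" "l = 0 \<or> s \<notin> A" by blast
  define w where "w = replicate l s @ z"
  have len: "length w + i = length x + l" using uvz(1,4) by (simp add: w_def)
  have "w \<in> words h m"
    using assms(1,6) s(1) len uvz(1) unfolding words_def w_def by auto
  moreover have "diverge u (replicate l s)" "diverge (replicate l s) v"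
    using s(2) unfolding A_def by (auto simp: diverge_def split: if_splits)
  then have "tdist x w = i + l" "tdist w y = j + l"
    using tdist_diverge[of u "replicate l s" z] tdist_diverge[of "replicate l s" v z] uvz
    by (simp_all add: w_def)
  ultimately show ?thesis using len by blast
qed

lemma geodesic_point:
  assumes "x \<in> words h m" "y \<in> words h m" "m \<ge> 2" "i + j = tdist x y"
  shows "\<exists>w\<in>words h m. tdist x w = i \<and> tdist w y = j"
proof -
  consider "i + length y < j + length x" | "j + length x < i + length y" | "i + length y = j + length x"
    by linarith
  then show ?thesis
  proof cases
    case 1
    have "length x + 0 \<le> h + i" using assms(1) by (simp add: words_def)
    from branch_down[OF assms 1 this] show ?thesis by auto
  next
    case 2
    have "length y + 0 \<le> h + j" "j + i = tdist y x"
      using assms(2,4) by (simp_all add: words_def tdist_commute)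
    from branch_down[OF assms(2,1,3) this(2) 2 this(1)] show ?thesis
      by (auto simp: tdist_commute)
  next
    case 3
    have "length x + 0 \<le> h + i" using assms(1) by (simp add: words_def)
    from branch_fork[OF assms 3 this] show ?thesis by auto
  qed
qed

section \<open>The first two metamour graphs of a tree\<close>

locale tall_tree =
  fixes h m :: nat
  assumes m: "m \<ge> 2" and h: "h \<ge> 5"
begin

abbreviation "V \<equiv> words h m"
abbreviation "T \<equiv> complete_tree h m"
abbreviation "E2 \<equiv> parcs ((metamour ^^ 2) T)"

text \<open>
  A tree is bipartite, so two steps of length 1 span 0 or 2, and two steps of length 2 span 0, 2
  or 4. This gives the first two metamour graphs.
\<close>

lemma metamour_arc_iff_tdist:
  "(x, y) \<in> parcs (metamour T) \<longleftrightarrow> x \<in> V \<and> y \<in> V \<and> tdist x y = 2"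
proof
  assume "(x, y) \<in> parcs (metamour T)"
  then obtain z where *: "x \<noteq> y" "(x, y) \<notin> parcs T" "(x, z) \<in> parcs T" "(z, y) \<in> parcs T"
    unfolding metamour_arc_iff[OF pair_graph_complete_tree] by blast
  then have "tdist x y \<le> 2"
    using tdist_triangle[of x y z] by (simp add: arc_complete_tree_iff)
  moreover have "tdist x y \<noteq> 0" "tdist x y \<noteq> 1"
    using * by (auto simp: arc_complete_tree_iff)
  ultimately have "tdist x y = 2" by linarith
  then show "x \<in> V \<and> y \<in> V \<and> tdist x y = 2"
    using *(3,4) by (simp add: arc_complete_tree_iff)
next
  assume *: "x \<in> V \<and> y \<in> V \<and> tdist x y = 2"
  then obtain z where "z \<in> V" "tdist x z = 1" "tdist z y = 1"
    using geodesic_point[of x h m y 1 1] m by auto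
  then show "(x, y) \<in> parcs (metamour T)"
    unfolding metamour_arc_iff[OF pair_graph_complete_tree] arc_complete_tree_iff using * by auto
qed

lemma E2_iff: "(x, y) \<in> E2 \<longleftrightarrow> x \<in> V \<and> y \<in> V \<and> tdist x y = 4"
proof -
  note iff = metamour_arc_iff[OF pair_graph_metamour[OF pair_graph_complete_tree]]
  have E2: "E2 = parcs (metamour (metamour T))" by (simp add: numeral_2_eq_2)
  show ?thesis
  proof
    assume "(x, y) \<in> E2"
    then obtain z where *: "x \<noteq> y" "(x, y) \<notin> parcs (metamour T)"
      "(x, z) \<in> parcs (metamour T)" "(z, y) \<in> parcs (metamour T)"
      unfolding E2 iff by blast
    note * = *[unfolded metamour_arc_iff_tdist]
    have "tdist x y \<le> 4" using tdist_triangle[of x y z] * by simp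
    moreover have "even (tdist x y)"
      using tdist_parity[of x y] tdist_parity[of x z] tdist_parity[of z y] * by simp presburger
    moreover have "tdist x y \<noteq> 0" "tdist x y \<noteq> 2" using * by auto
    ultimately have "tdist x y = 4" by presburger
    then show "x \<in> V \<and> y \<in> V \<and> tdist x y = 4" using * by blast
  next
    assume *: "x \<in> V \<and> y \<in> V \<and> tdist x y = 4"
    then obtain z where "z \<in> V" "tdist x z = 2" "tdist z y = 2"
      using geodesic_point[of x h m y 2 2] m by auto
    then show "(x, y) \<in> E2"
      unfolding E2 iff metamour_arc_iff_tdist using * by auto
  qed
qed

section \<open>Distances in the second metamour graph\<close>

text \<open>
  A walk in the second metamour graph advances by 4 in the tree, so \<open>tdist x y\<close> divided by 4 and
  rounded up is a lower bound for its length. For tree distance 2 it is 1, which is not attained,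
  as one step covers exactly 4. The pairs below need three steps although two would seem to do:
  the two vertices of depth 1 in a binary tree, a vertex on one of the two lowest levels and its
  grandparent, and two vertices of depth 3 separated by the root of a binary tree.
\<close>

definition exceptional :: "nat list \<Rightarrow> nat list \<Rightarrow> bool" where
  "exceptional x y \<longleftrightarrow>
     tdist x y = 2 \<and> m = 2 \<and> length x = 1 \<and> length y = 1 \<or>
     tdist x y = 2 \<and> length x \<noteq> length y \<and> h \<le> max (length x) (length y) + 1 \<or>
     tdist x y = 6 \<and> m = 2 \<and> length x = 3 \<and> length y = 3"

definition hop :: "nat list \<Rightarrow> nat list \<Rightarrow> nat" where
  "hop x y = (if exceptional x y then 3 else if tdist x y = 2 then 2 else (tdist x y + 3) div 4)"

lemma exceptional_commute: "exceptional x y \<longleftrightarrow> exceptional y x"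
  by (auto simp: exceptional_def tdist_commute max.commute)

lemma hop_commute: "hop x y = hop y x"
  using exceptional_commute[of x y] by (simp add: hop_def tdist_commute)

text \<open>
  In a binary tree every vertex but the root lies below one of the two vertices of depth 1, and is
  farther from the other one by 2.
\<close>

lemma top_siblings_dist:
  assumes "m = 2" "length x = 1" "length y = 1" "x \<in> V" "y \<in> V" "x \<noteq> y" "w \<in> V" "w \<noteq> []"
  shows "tdist x w + 1 = length w \<and> tdist w y = length w + 1 \<or>
         tdist w y + 1 = length w \<and> tdist x w = length w + 1"
proof -
  obtain s t where st: "x = [s]" "y = [t]" "s < 2" "t < 2" "s \<noteq> t"
  proof -
    obtain s t where "x = [s]" "y = [t]" using assms(2,3) by (auto simp: length_Suc_conv)
    then show thesis using assms(1,4-6) by (intro that[of s t]) (auto simp: words_def)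
  qed
  obtain w' r where w: "w = w' @ [r]" "r < 2"
    using assms(1,7,8) by (cases w rule: rev_cases) (auto simp: words_def)
  have below: "tdist [r] w + 1 = length w"
    using tdist_diverge[of "[]" w' "[r]"] by (simp add: w diverge_def)
  have other: "tdist [q] w = length w + 1" if "q \<noteq> r" for q
    using tdist_diverge[of "[q]" w "[]"] that by (simp add: w diverge_def)
  show ?thesis
  proof (cases "s = r")
    case True
    then show ?thesis using below other[of t] st tdist_commute[of w y] by simp
  next
    case False
    then have "t = r" using st w(2) by simp
    then show ?thesis using below other[of s] st False tdist_commute[of w y] by simp
  qed
qed

text \<open>
  A vertex at tree distance 4 from \<open>y\<close> is farther from \<open>x\<close> unless it descends from \<open>y\<close>; but the
  tree ends less than 4 levels below \<open>y\<close>.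
\<close>

lemma no_common_bottom:
  assumes "length y < length x" "h \<le> length x + 1" "tdist x y = 2" "w \<in> V"
    "tdist x w = 4" "tdist w y = 4"
  shows False
proof -
  have len: "length x = length y + 2"
    using assms(1,3) length_le_tdist[of x y] tdist_parity[of x y] by simp presburger
  obtain p where p: "x = p @ y" "length p = 2"
  proof -
    obtain u v z where "x = u @ z" "y = v @ z" "tdist x y = length u + length v"
      by (rule fork_cases)
    with len assms(3) show thesis by (intro that[of u]) auto
  qed
  obtain u v z where uvz: "y = u @ z" "w = v @ z" "diverge u v" "tdist y w = length u + length v"
    by (rule fork_cases)
  show False
  proof (cases "u = []")
    case True
    then have "length w = length y + 4" using uvz assms(6) by (simp add: tdist_commute)
    then show False using assms(2,4) len by (simp add: words_def)
  next
    case False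
    then have "tdist x w = length (p @ u) + length v"
      using tdist_diverge[of "p @ u" v z] uvz(3) by (auto simp: p(1) uvz(1,2) diverge_def)
    then show False using p(2) uvz(4) assms(5,6) by (simp add: tdist_commute)
  qed
qed

text \<open>
  The geodesic has its midpoint at the root, where a binary tree leaves no room to branch off.
\<close>

lemma no_common_depth_3:
  assumes "m = 2" "tdist x y = 6" "length x = 3" "length y = 3" "x \<in> V" "y \<in> V" "w \<in> V"
    "tdist x w = 4" "tdist w y = 4"
  shows False
proof -
  have "w \<noteq> []" using assms(3,8) tdist_le[of x w] by auto
  obtain u s where x: "x = u @ [s]" using assms(3) by (cases x rule: rev_cases) auto
  obtain v t where y: "y = v @ [t]" using assms(4) by (cases y rule: rev_cases) auto
  obtain w' r where w: "w = w' @ [r]" using \<open>w \<noteq> []\<close> by (cases w rule: rev_cases) auto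
  have "s \<noteq> t"
  proof
    assume "s = t"
    then have "tdist x y = word_dist (rev u) (rev v)" by (simp add: x y tdist_def)
    also have "\<dots> \<le> 4" using word_dist_le[of "rev u" "rev v"] assms(3,4) x y by simp
    finally show False using assms(2) by simp
  qed
  have far: "length z + length w = tdist z w" if "last z \<noteq> r" for z
    using tdist_diverge[of z w "[]"] that by (simp add: w diverge_def)
  have near: "tdist (q @ [r]) w \<le> length q + length w'" for q
    using word_dist_le[of "rev q" "rev w'"] by (simp add: w tdist_def)
  have "s < 2" "t < 2" "r < 2" using assms(1,5-7) x y w by (auto simp: words_def)
  with \<open>s \<noteq> t\<close> consider "s = r" "t \<noteq> r" | "t = r" "s \<noteq> r" by linarith
  then show False
  proof cases
    case 1
    then show False using far[of y] near[of u] assms x y w by (simp add: tdist_commute)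
  next
    case 2
    then show False using far[of x] near[of v] assms x y w by (simp add: tdist_commute)
  qed
qed

lemma exceptional_no_common:
  assumes "exceptional x y" "x \<in> V" "y \<in> V" "w \<in> V" "tdist x w = 4" "tdist w y = 4"
  shows False
proof -
  consider (sib) "tdist x y = 2" "m = 2" "length x = 1" "length y = 1"
    | (xy) "tdist x y = 2" "length y < length x" "h \<le> length x + 1"
    | (yx) "tdist x y = 2" "length x < length y" "h \<le> length y + 1"
    | (three) "tdist x y = 6" "m = 2" "length x = 3" "length y = 3"
    using assms(1) unfolding exceptional_def by linarith
  then show False
  proof cases
    case sib
    then have "x \<noteq> y" "w \<noteq> []" using assms(5) tdist_le[of x w] by auto
    then show False using top_siblings_dist[of x y w] sib assms by auto
  next
    case xy
    then show False using no_common_bottom[of y x w] assms by simp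
  next
    case yx
    then show False using no_common_bottom[of x y w] assms by (simp add: tdist_commute)
  next
    case three
    then show False using no_common_depth_3[of x y w] assms by simp
  qed
qed

lemma E2_relpow_tdist:
  assumes "(x, y) \<in> E2 ^^ n" "x \<in> V"
  shows "y \<in> V \<and> tdist x y \<le> 4 * n \<and> even (tdist x y)"
  using assms(1)
proof (induct n arbitrary: y)
  case 0
  then show ?case using assms(2) by simp
next
  case (Suc n)
  then obtain z where z: "(x, z) \<in> E2 ^^ n" "(z, y) \<in> E2" by auto
  have "tdist x y \<le> 4 * Suc n"
    using tdist_triangle[of x y z] Suc.hyps[OF z(1)] z(2) by (simp add: E2_iff)
  moreover have "even (tdist x y)"
    using tdist_parity[of x y] tdist_parity[of x z] tdist_parity[of z y] Suc.hyps[OF z(1)] z(2)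
    by (simp add: E2_iff) presburger
  ultimately show ?case using z(2) by (simp add: E2_iff)
qed

lemma hop_le:
  assumes "(x, y) \<in> E2 ^^ n" "x \<in> V"
  shows "hop x y \<le> n"
proof -
  note * = E2_relpow_tdist[OF assms]
  have two: "n \<ge> 2" if "tdist x y > 0" "tdist x y \<noteq> 4"
    using * that assms by (cases "n = 1") (auto simp: E2_iff)
  show ?thesis
  proof (cases "exceptional x y")
    case True
    then have "tdist x y = 2 \<or> tdist x y = 6" by (auto simp: exceptional_def)
    then have "n \<ge> 2" using two by auto
    moreover have "n \<noteq> 2"
    proof
      assume "n = 2"
      then obtain w where "(x, w) \<in> E2" "(w, y) \<in> E2"
        using assms(1) by (auto simp: numeral_2_eq_2)
      then show False using exceptional_no_common[OF True, of w] by (simp add: E2_iff)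
    qed
    ultimately show ?thesis using True by (simp add: hop_def)
  next
    case False
    then show ?thesis using * two by (auto simp: hop_def)
  qed
qed

lemma E2_sym: "(x, y) \<in> E2 \<longleftrightarrow> (y, x) \<in> E2"
  by (auto simp: E2_iff tdist_commute)

lemma E2_relpow_multiple:
  assumes "x \<in> V" "y \<in> V" "tdist x y = 4 * n"
  shows "(x, y) \<in> E2 ^^ n"
  using assms(1,3)
proof (induct n arbitrary: x)
  case 0
  then show ?case by simp
next
  case (Suc n)
  then obtain w where "w \<in> V" "tdist x w = 4" "tdist w y = 4 * n"
    using geodesic_point[of x h m y 4 "4 * n"] assms(2) m by auto
  then show ?case using Suc by (intro relpow_Suc_I2[of x w]) (auto simp: E2_iff)
qed

text \<open>
  Tree distance \<open>4 * n\<close> is covered by walking along the geodesic. For \<open>4 * n + 2\<close> the walk has to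
  lose 2: one step ends at a neighbour of the geodesic, hung to it at distance 3 from one of its
  ends. For tree distance 2 the intermediate vertex hangs at distance 3 from the middle.
\<close>

lemma E2_relpow_hop_generic:
  assumes "x \<in> V" "y \<in> V" "even (tdist x y)" "\<not> exceptional x y" "length y \<le> length x"
  shows "(x, y) \<in> E2 ^^ hop x y"
proof -
  have hx: "length x \<le> h" using assms(1) by (simp add: words_def)
  note A = assms(1,2) m
  consider n where "tdist x y = 4 * n" | "tdist x y = 2" | n where "tdist x y = 4 * n + 2" "n \<ge> 1"
  proof -
    obtain k where "tdist x y = 2 * k" using assms(3) by (rule evenE)
    moreover have "k = 2 * (k div 2) \<or> k = 1 \<or> k = 2 * (k div 2) + 1 \<and> 1 \<le> k div 2"
      by presburger
    ultimately show thesis using that(1)[of "k div 2"] that(2) that(3)[of "k div 2"] by auto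
  qed
  then show ?thesis
  proof cases
    case (1 n)
    then have "hop x y = n" using assms(4) by (simp add: hop_def)
    then show ?thesis using E2_relpow_multiple[OF assms(1,2) 1] by simp
  next
    case 2
    have "\<exists>w\<in>V. tdist x w = 4 \<and> tdist w y = 4"
    proof (cases "length x = length y")
      case True
      have "length x \<noteq> 0" using True 2 by auto
      show ?thesis
      proof (cases "length x = 1")
        case one: True
        then have "m \<ge> 3" using 2 True assms(4) m by (auto simp: exceptional_def)
        then show ?thesis using branch_fork[OF A, of 1 1 3] 2 True one h by auto
      next
        case False
        then show ?thesis using branch_up[OF A, of 1 1 1 3] 2 True hx \<open>length x \<noteq> 0\<close> by auto
      qed
    next
      case False
      then have "length x + 1 < h" using assms(4,5) 2 by (auto simp: exceptional_def max_def)
      then show ?thesis using branch_down[OF A, of 1 1 3] 2 False assms(5) by auto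
    qed
    then obtain w where "(x, w) \<in> E2" "(w, y) \<in> E2" using assms(1,2) by (auto simp: E2_iff)
    then have "(x, y) \<in> E2 ^^ Suc 1" by (intro relpow_Suc_I2[of x w]) simp_all
    moreover have "hop x y = Suc 1" using assms(4) 2 by (simp add: hop_def)
    ultimately show ?thesis by (simp only:)
  next
    case (3 n)
    have "\<exists>w\<in>V. tdist x w = 4 \<and> tdist w y = 4 * n \<or> tdist x w = 4 * n \<and> tdist w y = 4"
    proof -
      consider "3 + length y < 4 * n - 1 + length x" | "4 * n - 1 + length x < 3 + length y"
        | "3 + length y = 4 * n - 1 + length x" "length x \<ge> 4"
        | "3 + length y = 4 * n - 1 + length x" "length x = 3" "n = 1"
        using 3(2) tdist_le[of x y] 3(1) assms(5) by linarith
      then show ?thesis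
      proof cases
        case 1
        then show ?thesis using branch_down[OF A, of 3 "4 * n - 1" 1] 3 hx by auto
      next
        case 2
        then show ?thesis using branch_down'[OF A, of 3 "4 * n - 1" 1] 3 hx assms(5) by auto
      next
        case c: 3
        then show ?thesis using branch_up[OF A, of 3 "4 * n - 1" 1 1] 3 hx by auto
      next
        case c: 4
        then have "m \<ge> 3" using 3 assms(4) m by (auto simp: exceptional_def)
        then show ?thesis using branch_fork[OF A, of 3 3 1] 3 c h by auto
      qed
    qed
    then obtain w where w: "w \<in> V"
      "tdist x w = 4 \<and> tdist w y = 4 * n \<or> tdist x w = 4 * n \<and> tdist w y = 4" by blast
    then have "(x, y) \<in> E2 ^^ Suc n"
      using E2_relpow_multiple[of x w n] E2_relpow_multiple[of w y n] assms(1,2)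
      by (auto simp: E2_iff intro: relpow_Suc_I2 relpow_Suc_I simp del: relpow.simps)
    moreover have "hop x y = Suc n" using 3 assms(4) by (simp add: hop_def)
    ultimately show ?thesis by simp
  qed
qed

lemma E2_relpow_sym: "(x, y) \<in> E2 ^^ n \<Longrightarrow> (y, x) \<in> E2 ^^ n"
proof (induct n arbitrary: y)
  case (Suc n)
  then obtain z where "(x, z) \<in> E2 ^^ n" "(z, y) \<in> E2" by auto
  then show ?case using Suc.hyps E2_sym by (metis relpow_Suc_I2)
qed simp

text \<open>
  An exceptional pair is left by one step to a vertex \<open>w\<close> at tree distance 2 from the other end,
  chosen away from the bottom levels so that the pair formed with \<open>w\<close> is not exceptional.
\<close>

lemma E2_relpow_hop:
  assumes "x \<in> V" "y \<in> V" "even (tdist x y)" "length y \<le> length x"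
  shows "(x, y) \<in> E2 ^^ hop x y"
proof (cases "exceptional x y")
  case True
  note A = assms(1,2) m
  have hx: "length x \<le> h" using assms(1) by (simp add: words_def)
  have "\<exists>w\<in>V. (tdist x w = 4 \<and> tdist w y = 2 \<and> length w \<noteq> length y \<and> max (length w) (length y) + 1 < h)"
  proof -
    consider (sib) "tdist x y = 2" "m = 2" "length x = 1" "length y = 1"
      | (xy) "tdist x y = 2" "length y < length x" "h \<le> length x + 1"
      | (three) "tdist x y = 6" "m = 2" "length x = 3" "length y = 3"
      using True assms(4) unfolding exceptional_def by linarith
    then show ?thesis
    proof cases
      case sib
      then show ?thesis using branch_down'[OF A, of 2 0 2] h by auto
    next
      case xy
      have len: "length x = length y + 2"
        using xy length_le_tdist[of x y] tdist_parity[of x y] by simp presburger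
      then show ?thesis using branch_up[OF A, of 2 0 2 2] xy h hx by auto
    next
      case three
      then show ?thesis using branch_down'[OF A, of 4 2 0] h by auto
    qed
  qed
  then obtain w where w: "w \<in> V" "tdist x w = 4" "tdist w y = 2" "length w \<noteq> length y"
    "max (length w) (length y) + 1 < h" by blast
  then have ne: "\<not> exceptional w y" by (auto simp: exceptional_def)
  then have "hop w y = 2" using w by (simp add: hop_def)
  moreover have "(w, y) \<in> E2 ^^ hop w y"
    using E2_relpow_hop_generic[of w y] E2_relpow_sym E2_relpow_hop_generic[of y w] w assms(2) ne
      tdist_commute[of w y] exceptional_commute[of w y] hop_commute[of w y]
    by (cases "length y \<le> length w") auto
  moreover have "(x, w) \<in> E2" using w assms(1) by (simp add: E2_iff)
  ultimately have "(x, y) \<in> E2 ^^ Suc 2" by (metis relpow_Suc_I2)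
  then show ?thesis using True by (simp add: hop_def del: relpow.simps)
next
  case False
  then show ?thesis using E2_relpow_hop_generic[OF assms(1-3)] assms(4) by blast
qed

text \<open>
  The distance in the second metamour graph; its components are the two classes of depths modulo
  2.
\<close>

lemma at_dist_E2_iff:
  assumes "x \<in> V"
  shows "at_dist E2 n x y \<longleftrightarrow> y \<in> V \<and> even (tdist x y) \<and> n = hop x y"
proof -
  have hop: "at_dist E2 (hop x y) x y" if "y \<in> V" "even (tdist x y)"
  proof -
    have "(x, y) \<in> E2 ^^ hop x y"
      using E2_relpow_hop[of x y] E2_relpow_hop[of y x] E2_relpow_sym that assms
        tdist_commute[of x y] hop_commute[of x y]
      by (cases "length y \<le> length x") auto
    then show ?thesis unfolding at_dist_def using hop_le assms by (meson not_less)
  qed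
  show ?thesis
  proof
    assume *: "at_dist E2 n x y"
    then have "y \<in> V" "even (tdist x y)"
      using E2_relpow_tdist[of x y n] assms unfolding at_dist_def by blast+
    moreover from this have "n = hop x y" using at_dist_unique[OF *] hop by blast
    ultimately show "y \<in> V \<and> even (tdist x y) \<and> n = hop x y" by blast
  qed (use hop in auto)
qed


section \<open>Common vertices\<close>

text \<open>
  The values of \<open>hop\<close> at small tree distances decide which third vertices are suitable; pairs at
  tree distance 8 are always at distance 2, those at tree distance 2 and 6 if their depths avoid
  the exceptional ones.
\<close>

lemma hop_eq:
  "\<not> exceptional x y \<Longrightarrow> tdist x y \<noteq> 2 \<Longrightarrow> hop x y = (tdist x y + 3) div 4"
  by (simp add: hop_def)

lemma hop_tdist_8: "tdist x y = 8 \<Longrightarrow> hop x y = 2"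
  by (simp add: hop_def exceptional_def)

lemma hop_tdist_6: "tdist x y = 6 \<Longrightarrow> length x \<noteq> 3 \<or> length y \<noteq> 3 \<Longrightarrow> hop x y = 2"
  by (auto simp: hop_def exceptional_def)

lemma hop_tdist_2:
  "tdist x y = 2 \<Longrightarrow> length x \<noteq> length y \<Longrightarrow> max (length x) (length y) + 1 < h \<Longrightarrow> hop x y = 2"
  by (auto simp: hop_def exceptional_def)

lemma hop_tdist_2_level:
  "tdist x y = 2 \<Longrightarrow> length x = length y \<Longrightarrow> length x \<noteq> 1 \<Longrightarrow> hop x y = 2"
  by (auto simp: hop_def exceptional_def)

lemmas hop_twoI = hop_tdist_8 hop_tdist_6 hop_tdist_2 hop_tdist_2_level

lemma hop_eq_0_iff: "even (tdist x y) \<Longrightarrow> hop x y = 0 \<longleftrightarrow> x = y"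
  unfolding hop_def by (auto simp: exceptional_def div_eq_0_iff elim!: evenE)

lemma hop_eq_1_iff: "even (tdist x y) \<Longrightarrow> hop x y = 1 \<longleftrightarrow> tdist x y = 4"
  unfolding hop_def by (auto simp: exceptional_def elim!: evenE)

lemma level_diff:
  "tdist x y = 4 \<Longrightarrow> length y \<le> length x \<Longrightarrow>
    length x = length y \<or> length x = length y + 2 \<or> length x = length y + 4"
  using length_le_tdist[of x y] tdist_parity[of x y] by simp presburger

text \<open>
  The common vertex required in \<open>dyadic_metamours\<close>. Evenness puts it into the component of \<open>x\<close> and
  \<open>y\<close>, where \<open>hop\<close> is the distance.
\<close>

definition common_hop :: "nat \<Rightarrow> nat \<Rightarrow> nat list \<Rightarrow> nat list \<Rightarrow> bool" where
  "common_hop a b x y \<longleftrightarrow> (\<exists>z\<in>V. even (tdist x z) \<and> even (tdist z y) \<and>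
     hop x z \<in> {a<..b} \<and> hop z y \<in> {a<..b})"

lemma common_hop_commute: "common_hop a b x y \<longleftrightarrow> common_hop a b y x"
  unfolding common_hop_def by (auto simp: tdist_commute hop_commute)

lemma common_hopI:
  "\<exists>z\<in>V. even (tdist x z) \<and> even (tdist z y) \<and> hop x z \<in> {a<..b} \<and> hop z y \<in> {a<..b} \<Longrightarrow> common_hop a b x y"
  by (simp add: common_hop_def)

text \<open>
  The midpoint of the geodesic is at tree distance 2 from both ends and would do, were it not that
  a pair at tree distance 2 can be exceptional. Where this may happen the vertex is moved to tree
  distances 6 and 8, by climbing above the lowest common ancestor. If \<open>y\<close> is an ancestor of \<open>x\<close>,
  then another grandchild of \<open>y\<close> replaces the midpoint. If \<open>x\<close> has depth 3 and \<open>y\<close> depth 1,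
  climbing is impossible, but then the tree is high enough to descend to depth 5.
\<close>

lemma common_hop_tdist_4_generic:
  assumes "x \<in> V" "y \<in> V" "tdist x y = 4" "length y \<le> length x"
  shows "common_hop 1 2 x y"
proof -
  have hx: "length x \<le> h" using assms(1) by (simp add: words_def)
  note A = assms(1,2) m
  consider (anc) "length x = length y + 4" | (level_low) "length x = length y" "length x + 2 < h + 1"
    | (level_high) "length x = length y" "h \<le> length x + 1" | (skew_root) "length x = 3" "length y = 1"
    | (skew) "length x = length y + 2" "length y \<ge> 2"
    using level_diff[OF assms(3,4)] tdist_le[of x y] assms(3) by linarith
  then show ?thesis
  proof cases
    case anc
    have "\<exists>z\<in>V. tdist x z = 6 \<and> tdist z y = 2 \<and> length z = length y + 2"
      using branch_fork[OF A, of 4 0 2] anc assms(3) hx by auto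
    then obtain z where "z \<in> V" "tdist x z = 6" "tdist z y = 2" "length z = length y + 2" by blast
    then show ?thesis using anc hx
      by (intro common_hopI bexI[of _ z]) (auto simp: hop_twoI)
  next
    case level_low
    obtain z where "z \<in> V" "tdist x z = 2" "tdist z y = 2" "length z + 2 = length x"
      using branch_fork[OF A, of 2 2 0] level_low assms(3) by auto
    then show ?thesis using level_low
      by (intro common_hopI bexI[of _ z]) (auto simp: hop_twoI)
  next
    case level_high
    obtain z where "z \<in> V" "tdist x z = 6" "tdist z y = 6"
      using branch_up[OF A, of 2 2 2 4] level_high assms(3) h hx by auto
    then show ?thesis using level_high h
      by (intro common_hopI bexI[of _ z]) (auto simp: hop_twoI)
  next
    case skew_root
    obtain z where "z \<in> V" "tdist x z = 6" "tdist z y = 6" "length z = 5"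
      using branch_down[OF A, of 2 2 4] skew_root assms(3) h by auto
    then show ?thesis
      by (intro common_hopI bexI[of _ z]) (auto simp: hop_twoI)
  next
    case skew
    obtain z where "z \<in> V" "tdist x z = 8" "tdist z y = 6" "length z = length x"
      using branch_up[OF A, of 3 1 1 5] skew assms(3) hx by auto
    then show ?thesis using skew
      by (intro common_hopI bexI[of _ z]) (auto simp: hop_twoI)
  qed
qed

lemma common_hop_tdist_4:
  assumes "x \<in> V" "y \<in> V" "tdist x y = 4"
  shows "common_hop 1 2 x y"
  using common_hop_tdist_4_generic[of x y] common_hop_tdist_4_generic[of y x] assms common_hop_commute[of 1 2 x y]
  by (cases "length y \<le> length x") (auto simp: tdist_commute)

text \<open>
  The vertices of depth 1 in a binary tree of height 5 or 6. A vertex at distance 2 from both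
  would have to lie at tree distances 6 and 8, hence at depth 7.
\<close>

definition top_pair :: "nat list \<Rightarrow> nat list \<Rightarrow> bool" where
  "top_pair x y \<longleftrightarrow> m = 2 \<and> h \<le> 6 \<and> x \<in> V \<and> y \<in> V \<and> x \<noteq> y \<and> length x = 1 \<and> length y = 1"

lemma hop_far: "tdist x z = 4 * q + 4 \<Longrightarrow> q \<ge> 1 \<Longrightarrow> hop x z = q + 1"
  by (simp add: hop_def exceptional_def)

lemma hop_near: "tdist x z = 4 * q + 2 \<Longrightarrow> q \<ge> 1 \<Longrightarrow> length x \<noteq> 3 \<or> length z \<noteq> 3 \<Longrightarrow> hop x z = q + 1"
  by (auto simp: hop_def exceptional_def)

text \<open>
  Branching off near the ends of the short geodesic yields a vertex at tree distances 6 and 8. For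
  the two vertices of depth 1 in a binary tree it has depth 7, which \<open>top_pair\<close> rules out.
\<close>

lemma common_hop_odd_hop_exceptional:
  assumes "x \<in> V" "y \<in> V" "exceptional x y" "\<not> top_pair x y" "length y \<le> length x"
  shows "common_hop 1 2 x y"
proof -
  have hx: "length x \<le> h" using assms(1) by (simp add: words_def)
  note A = assms(1,2) m
  consider (sib) "tdist x y = 2" "m = 2" "length x = 1" "length y = 1"
    | (xy) "tdist x y = 2" "length y < length x" "h \<le> length x + 1"
    | (three) "tdist x y = 6" "m = 2" "length x = 3" "length y = 3"
    using assms(3,5) unfolding exceptional_def by linarith
  then show ?thesis
  proof cases
    case sib
    then have "x \<noteq> y" by auto
    with sib assms(1,2,4) have "\<not> h \<le> 6" unfolding top_pair_def by blast
    then obtain z where "z \<in> V" "tdist x z = 6" "tdist z y = 8" "length z = 7"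
      using branch_down[OF A, of 0 2 6] sib by auto
    then show ?thesis
      by (intro common_hopI bexI[of _ z]) (auto simp: hop_twoI)
  next
    case xy
    have len: "length x = length y + 2"
      using xy length_le_tdist[of x y] tdist_parity[of x y] by simp presburger
    then obtain z where "z \<in> V" "tdist x z = 8" "tdist z y = 6" "length z = length y + 2"
      using branch_up[OF A, of 2 0 2 6] xy h hx by auto
    then show ?thesis
      by (intro common_hopI bexI[of _ z]) (auto simp: hop_twoI)
  next
    case three
    then obtain z where "z \<in> V" "tdist x z = 6" "tdist z y = 8" "length z = 5"
      using branch_down[OF A, of 2 4 4] h by auto
    then show ?thesis
      by (intro common_hopI bexI[of _ z]) (auto simp: hop_twoI)
  qed
qed

text \<open>
  The tree distance is \<open>2 * i\<close>, and hanging a vertex to the midpoint by a path of length \<open>l\<close>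
  brings both distances up to the next multiple \<open>4 * (q + 1)\<close> of 4, where \<open>hop\<close> is \<open>q + 1\<close> without
  exception.
\<close>

lemma common_hop_odd_hop_generic:
  assumes "x \<in> V" "y \<in> V" "q \<ge> 1" "length y \<le> length x"
    and "tdist x y = 8 * q + 2 \<or> tdist x y = 8 * q + 4"
  shows "common_hop q (2 * q) x y"
proof -
  have hx: "length x \<le> h" using assms(1) by (simp add: words_def)
  note A = assms(1,2) m
  obtain l where l: "l = 2 \<or> l = 3" "tdist x y + 2 * l = 8 * q + 8" using assms(5) by auto
  define i where "i = tdist x y div 2"
  have ii: "i + i = tdist x y" using assms(5) by (auto simp: i_def)
  have il: "i + l = 4 * q + 4" using ii l(2) by simp
  have i: "i \<ge> 5" using ii l assms(3) by linarith
  have far: "common_hop q (2 * q) x y" if "z \<in> V" "tdist x z = i + l" "tdist z y = i + l" for z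
    using that assms(3) il by (intro common_hopI bexI[of _ z]) (auto simp: hop_far)
  consider (down) "length y < length x" | (up) "length x = length y" "i < length x"
    | (wide) "length x = i" "length y = i" "m \<ge> 3" | (root) "length x = i" "length y = i" "m = 2"
    using assms(4) tdist_le[of x y] ii m by linarith
  then show ?thesis
  proof cases
    case down
    then show ?thesis using branch_down[OF A ii, of l] hx l(1) i far by auto
  next
    case up
    then show ?thesis using branch_up[OF A ii, of 1 l] hx l(1) i far by auto
  next
    case wide
    then show ?thesis using branch_fork[OF A ii, of l] hx l(1) h far by auto
  next
    \<comment> \<open>The root of a binary tree has no third child: take the root or branch off one level below.\<close>
    case root
    from l(1) show ?thesis
    proof
      assume "l = 2"
      then obtain z where "z \<in> V" "tdist x z = i" "tdist z y = i" "length z = 0"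
        using branch_fork[OF A ii, of 0] root hx by auto
      then show ?thesis using il \<open>l = 2\<close> assms(3)
        by (intro common_hopI bexI[of _ z]) (auto simp: hop_near[of _ _ q])
    next
      assume "l = 3"
      have "(i - 1) + (i + 1) = tdist x y" "i - 1 + length y < i + 1 + length x"
        "length x + 2 \<le> h + (i - 1)"
        using root h i ii by linarith+
      moreover have "i - 1 + 2 = i + 1" "i + 1 + 2 = i + 3" using i by linarith+
      ultimately obtain z where "z \<in> V" "tdist x z = i + 1" "tdist z y = i + 3"
        using branch_down[OF A, of "i - 1" "i + 1" 2] by metis
      moreover from this have "hop x z = q + 1" "hop z y = q + 1"
        using hop_near[of x z q] hop_far[of z y q] il \<open>l = 3\<close> assms(3) i root(1) by linarith+
      ultimately show ?thesis using il \<open>l = 3\<close> assms(3)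
        by (intro common_hopI bexI[of _ z] conjI) simp_all
    qed
  qed
qed

lemma common_hop_odd_hop:
  assumes "x \<in> V" "y \<in> V" "even (tdist x y)" "hop x y = 2 * q + 1" "q \<ge> 1" "\<not> top_pair x y"
  shows "common_hop q (2 * q) x y"
proof (cases "exceptional x y")
  case True
  then have "q = 1" using assms(4) by (simp add: hop_def)
  moreover have "\<not> top_pair y x" using assms(6) by (auto simp: top_pair_def)
  ultimately show ?thesis
    using common_hop_odd_hop_exceptional[of x y] common_hop_odd_hop_exceptional[of y x] True assms(1,2,6)
      exceptional_commute[of x y] common_hop_commute[of 1 2 x y]
    by (cases "length y \<le> length x") auto
next
  case False
  have "tdist x y \<noteq> 2"
  proof
    assume "tdist x y = 2"
    then have "2 = 2 * q + 1" using False assms(4) by (simp add: hop_def)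
    then show False by presburger
  qed
  moreover from this have "(tdist x y + 3) div 4 = 2 * q + 1"
    using False assms(4) by (simp add: hop_def)
  ultimately have *: "tdist x y = 8 * q + 2 \<or> tdist x y = 8 * q + 4" using assms(3) by presburger
  then show ?thesis
    using common_hop_odd_hop_generic[of x y q] common_hop_odd_hop_generic[of y x q] assms(1,2,5)
      common_hop_commute[of q "2 * q" x y] tdist_commute[of x y]
    by (cases "length y \<le> length x") auto
qed

lemma top_pair_tdist:
  assumes "top_pair x y"
  shows "tdist x y = 2"
proof -
  have xy: "length x = 1" "length y = 1" "x \<noteq> y" using assms by (auto simp: top_pair_def)
  then have "tdist x y \<le> 2" "even (tdist x y)" "tdist x y \<noteq> 0"
    using tdist_le[of x y] tdist_parity[of x y] by auto
  then show ?thesis by presburger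
qed

lemma top_pair_hop:
  assumes "top_pair x y"
  shows "hop x y = 3"
proof -
  have "exceptional x y"
    using top_pair_tdist[OF assms] assms unfolding exceptional_def top_pair_def by blast
  then show ?thesis by (simp add: hop_def)
qed

text \<open>
  Since only depths 1, 3 and 5 occur in their component, a third vertex is at tree distances 2 and
  4, or 4 and 6, from the two; so one distance is 1 and the other 2.
\<close>

lemma top_pair_hops:
  assumes "top_pair x y" "z \<in> V" "z \<noteq> x" "z \<noteq> y" "even (tdist x z)"
  shows "hop x z = 1 \<and> hop z y = 2 \<or> hop x z = 2 \<and> hop z y = 1"
proof -
  have xy: "length x = 1" "length y = 1" "x \<noteq> y" "m = 2" "h \<le> 6" "x \<in> V" "y \<in> V"
    using assms(1) by (auto simp: top_pair_def)
  have "odd (length z)" using tdist_parity[of x z] assms(5) xy(1) by simp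
  moreover have "length z \<le> 6" using assms(2) xy(5) by (simp add: words_def)
  ultimately have "length z = 1 \<or> length z = 3 \<or> length z = 5" by presburger
  then have z: "length z \<in> {1, 3, 5}" "z \<noteq> []" by auto
  have one: "hop u w = 1" if "tdist u w = 4" for u w using that hop_eq_1_iff by simp
  consider "tdist x z + 1 = length z" "tdist z y = length z + 1"
    | "tdist z y + 1 = length z" "tdist x z = length z + 1"
    using top_siblings_dist[of x y z] xy assms(2) z by auto
  then show ?thesis
  proof cases
    case 1
    then have "length z = 3 \<or> length z = 5" using z assms(3) by (auto simp: eq_commute[of x z])
    then show ?thesis using 1 xy h one hop_tdist_2[of x z] hop_tdist_6[of z y] by auto
  next
    case 2
    then have "length z = 3 \<or> length z = 5" using z assms(4) by auto
    then show ?thesis using 2 xy h one hop_tdist_2[of z y] hop_tdist_6[of x z] by auto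
  qed
qed

lemma tdist_le_height: "x \<in> V \<Longrightarrow> y \<in> V \<Longrightarrow> tdist x y \<le> 2 * h"
  using tdist_le[of x y] by (simp add: words_def)

lemma hop_le_height:
  assumes "x \<in> V" "y \<in> V"
  shows "hop x y \<le> max 3 ((h + 1) div 2)"
  using tdist_le_height[OF assms] by (auto simp: hop_def)

lemma at_dist_E2_pos_iff:
  assumes "n > 0"
  shows "at_dist E2 n x y \<longleftrightarrow> x \<in> V \<and> y \<in> V \<and> even (tdist x y) \<and> n = hop x y"
proof -
  have "x \<in> V" if "at_dist E2 n x y"
  proof -
    obtain k where "n = Suc k" using assms by (cases n) auto
    then have "(x, y) \<in> E2 ^^ Suc k" using that by (simp only: at_dist_def)
    then obtain z where "(x, z) \<in> E2" by (blast dest: relpow_Suc_D2)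
    then show ?thesis by (simp only: E2_iff)
  qed
  then show ?thesis using at_dist_E2_iff[of x n y] by blast
qed

text \<open>
  \<open>dyadic_metamours\<close>, started at the second metamour graph.
\<close>

lemma metamour_arcs:
  "(x, y) \<in> parcs ((metamour ^^ (k + 2)) T) \<longleftrightarrow>
    \<not> top_pair x y \<and> x \<in> V \<and> y \<in> V \<and> x \<noteq> y \<and> even (tdist x y) \<and>
    ceillog2 (hop x y) \<le> k \<and> even (ceillog2 (hop x y) + k)"
proof -
  have common_hopE: "\<exists>z a b. at_dist E2 a x z \<and> at_dist E2 b z y \<and> a \<in> {p<..q} \<and> b \<in> {p<..q}"
    if "common_hop p q x y" "x \<in> V" "y \<in> V" for p q x y
  proof -
    obtain z where "z \<in> V" "even (tdist x z)" "even (tdist z y)" "hop x z \<in> {p<..q}" "hop z y \<in> {p<..q}"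
      using \<open>common_hop p q x y\<close> unfolding common_hop_def by blast
    then show ?thesis
      using at_dist_E2_iff[of x "hop x z" z] at_dist_E2_iff[of z "hop z y" y] that(2,3) by blast
  qed
  have "(x, y) \<in> parcs ((metamour ^^ k) ((metamour ^^ 2) T)) \<longleftrightarrow>
    \<not> top_pair x y \<and> (\<exists>n>0. at_dist E2 n x y \<and> ceillog2 n \<le> k \<and> even (ceillog2 n + k))"
  proof (rule dyadic_metamours)
    show "pair_graph ((metamour ^^ 2) T)"
      by (intro pair_graph_metamour_funpow pair_graph_complete_tree)
  next
    fix x y assume "at_dist E2 1 x y"
    then have *: "x \<in> V" "y \<in> V" "tdist x y = 4"
      using at_dist_E2_pos_iff[of 1 x y] hop_eq_1_iff[of x y] by simp_all
    from common_hopE[OF common_hop_tdist_4[OF *] *(1,2)]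
    obtain z a b where "at_dist E2 a x z" "at_dist E2 b z y" "a \<in> {1<..2}" "b \<in> {1<..2}" by blast
    moreover from this(3,4) have "a = 2" "b = 2" by simp_all
    ultimately show "\<exists>z. at_dist E2 2 x z \<and> at_dist E2 2 z y" by blast
  next
    fix x y and j :: nat
    assume j: "1 \<le> j" "at_dist E2 (2 ^ j + 1) x y" "\<not> top_pair x y"
    have p: "(2::nat) ^ j = 2 * 2 ^ (j - 1)" using j(1) by (cases j) simp_all
    have *: "x \<in> V" "y \<in> V" "even (tdist x y)" "hop x y = 2 * 2 ^ (j - 1) + 1"
      using at_dist_E2_pos_iff[of "2 ^ j + 1" x y] j(2) p by simp_all
    from common_hopE[OF common_hop_odd_hop[OF * _ j(3)] *(1,2)]
    show "\<exists>z a b. at_dist E2 a x z \<and> at_dist E2 b z y \<and>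
        a \<in> {2 ^ (j - 1)<..2 ^ j} \<and> b \<in> {2 ^ (j - 1)<..2 ^ j}"
      unfolding p by simp
  next
    fix x y assume *: "top_pair x y"
    show "at_dist E2 3 x y"
      using at_dist_E2_pos_iff[of 3 x y] top_pair_hop[OF *] top_pair_tdist[OF *]
        *[unfolded top_pair_def] by auto
  next
    fix x y z and a b :: nat
    assume *: "top_pair x y" "at_dist E2 a x z" "at_dist E2 b z y" "0 < a" "0 < b"
    note at = at_dist_E2_pos_iff[THEN iffD1, OF *(4,2)] at_dist_E2_pos_iff[THEN iffD1, OF *(5,3)]
    then have "z \<noteq> x" "z \<noteq> y" using *(4,5) hop_eq_0_iff[of x z] hop_eq_0_iff[of z y] by auto
    with top_pair_hops[OF *(1), of z] at have "a = 1 \<and> b = 2 \<or> a = 2 \<and> b = 1" by auto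
    then show "odd (ceillog2 a + ceillog2 b)" by auto
  next
    fix x y u v and n :: nat
    assume *: "top_pair x y" "at_dist E2 n u v"
    show "n \<le> 4"
    proof (cases "n > 0")
      case True
      then have "u \<in> V" "v \<in> V" "n = hop u v" using at_dist_E2_pos_iff *(2) by blast+
      then show ?thesis using hop_le_height[of u v] *(1) by (auto simp: top_pair_def)
    qed simp
  qed
  moreover have "(\<exists>n>0. at_dist E2 n x y \<and> P n) \<longleftrightarrow>
      x \<in> V \<and> y \<in> V \<and> x \<noteq> y \<and> even (tdist x y) \<and> P (hop x y)" for P
  proof
    assume "\<exists>n>0. at_dist E2 n x y \<and> P n"
    then obtain n where "n > 0" "at_dist E2 n x y" "P n" by blast
    then show "x \<in> V \<and> y \<in> V \<and> x \<noteq> y \<and> even (tdist x y) \<and> P (hop x y)"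
      using at_dist_E2_pos_iff[of n x y] hop_eq_0_iff[of x y] by auto
  next
    assume "x \<in> V \<and> y \<in> V \<and> x \<noteq> y \<and> even (tdist x y) \<and> P (hop x y)"
    moreover from this have "hop x y > 0" using hop_eq_0_iff[of x y] by simp
    ultimately show "\<exists>n>0. at_dist E2 n x y \<and> P n"
      using at_dist_E2_pos_iff[of "hop x y" x y] by blast
  qed
  moreover have "(metamour ^^ (k + 2)) T = (metamour ^^ k) ((metamour ^^ 2) T)"
    by (simp only: funpow_add comp_apply)
  ultimately show ?thesis by (simp only:)
qed

lemma late_index:
  assumes "h \<le> 2 ^ k"
  obtains k' where "k = k' + 2" "k' \<ge> 1"
proof -
  have "2 < k"
  proof (rule ccontr)
    assume "\<not> 2 < k"
    then have "(2::nat) ^ k \<le> 2 ^ 2" by (intro power_increasing) simp_all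
    then show False using assms h by simp
  qed
  then show thesis by (intro that[of "k - 2"]) simp_all
qed

section \<open>Stabilisation\<close>

text \<open>
  The largest distance is half the height, rounded up; this is where the height bounds the levels.
\<close>

lemma ceillog2_hop_le:
  assumes "h \<le> 2 ^ (k + 2)" "k \<ge> 1" "x \<in> V" "y \<in> V" "x \<noteq> y" "even (tdist x y)"
  shows "ceillog2 (hop x y) \<le> k + 1"
proof -
  have "(2::nat) ^ 1 \<le> 2 ^ k" using assms(2) by (intro power_increasing) simp_all
  then have "hop x y \<le> 2 ^ (k + 1)" using hop_le_height[OF assms(3,4)] assms(1) by simp
  moreover have "hop x y > 0" using hop_eq_0_iff[of x y] assms(5,6) by simp
  ultimately show ?thesis by (simp add: ceillog2_le_iff)
qed

lemma late_arcs:
  assumes "h \<le> 2 ^ k"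
  shows "(x, y) \<in> parcs ((metamour ^^ k) T) \<longleftrightarrow>
    \<not> top_pair x y \<and> x \<in> V \<and> y \<in> V \<and> x \<noteq> y \<and> even (tdist x y) \<and> even (ceillog2 (hop x y) + k)"
proof -
  obtain k' where k': "k = k' + 2" "k' \<ge> 1" using assms by (rule late_index)
  have "ceillog2 (hop x y) \<le> k'"
    if "x \<in> V" "y \<in> V" "x \<noteq> y" "even (tdist x y)" "even (ceillog2 (hop x y) + k')"
  proof -
    have "ceillog2 (hop x y) \<le> k' + 1" using ceillog2_hop_le assms k' that(1-4) by simp
    moreover have "ceillog2 (hop x y) \<noteq> k' + 1" using that(5) by auto
    ultimately show ?thesis by simp
  qed
  then show ?thesis unfolding k'(1) metamour_arcs by auto
qed

lemma metamour_eqI: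
  "parcs ((metamour ^^ i) T) = parcs ((metamour ^^ j) T) \<Longrightarrow> (metamour ^^ i) T = (metamour ^^ j) T"
  using pverts_metamour_funpow[of i T] pverts_metamour_funpow[of j T]
  by (intro pair_pre_digraph.equality) simp_all

text \<open>
  The words \<open>0\<dots>0\<close> and \<open>1\<dots>1\<close> part at the root, so they realise any even tree distance up to the
  diameter.
\<close>

lemma zeros_ones:
  assumes "n \<le> h"
  shows "replicate n 0 \<in> V" "replicate n (Suc 0) \<in> V" "tdist (replicate n 0) (replicate n (Suc 0)) = 2 * n"
    "n \<noteq> 1 \<Longrightarrow> \<not> top_pair (replicate n 0) (replicate n (Suc 0))"
    "n \<noteq> 0 \<Longrightarrow> replicate n 0 \<noteq> replicate n (Suc 0)"
proof -
  show "replicate n 0 \<in> V" "replicate n (Suc 0) \<in> V" using assms m by (auto simp: words_def)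
  have "diverge (replicate n 0) (replicate n (Suc 0))"
    by (cases n) (auto simp: diverge_def last_conv_nth nth_append replicate_append_same[symmetric])
  from tdist_diverge[OF this, of "[]"]
  show "tdist (replicate n 0) (replicate n (Suc 0)) = 2 * n" by simp
  show "n \<noteq> 1 \<Longrightarrow> \<not> top_pair (replicate n 0) (replicate n (Suc 0))" by (simp add: top_pair_def)
  show "n \<noteq> 0 \<Longrightarrow> replicate n 0 \<noteq> replicate n (Suc 0)" by (simp add: replicate_eq_replicate)
qed

text \<open>
  For \<open>k \<ge> 2\<close> the graphs \<open>k\<close> and \<open>k + 2\<close> differ by the pairs of level \<open>k\<close>. The lowest distance of
  that level, \<open>2 ^ (k - 1) + 1\<close>, is realised by vertices of depth \<open>2 ^ k + 1\<close> on different sides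
  of the root, hence as soon as \<open>2 ^ k < h\<close>.
\<close>

lemma periodic_step_iff: "(metamour ^^ k) T = (metamour ^^ (k + 2)) T \<longleftrightarrow> h \<le> 2 ^ k"
proof
  assume le: "h \<le> 2 ^ k"
  also have "(2::nat) ^ k \<le> 2 ^ (k + 2)" by simp
  finally have le2: "h \<le> 2 ^ (k + 2)" .
  have "(x, y) \<in> parcs ((metamour ^^ k) T) \<longleftrightarrow> (x, y) \<in> parcs ((metamour ^^ (k + 2)) T)" for x y
    unfolding late_arcs[OF le] late_arcs[OF le2] by simp
  then show "(metamour ^^ k) T = (metamour ^^ (k + 2)) T"
    by (intro metamour_eqI) (auto simp del: funpow.simps)
next
  assume eq: "(metamour ^^ k) T = (metamour ^^ (k + 2)) T"
  show "h \<le> 2 ^ k"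
  proof (rule ccontr)
    assume "\<not> h \<le> 2 ^ k"
    then have hk: "2 ^ k + 1 \<le> h" by simp
    consider "k = 0" | "k = 1" | k' where "k = k' + 2"
      by (metis One_nat_def Suc_eq_plus1 add_2_eq_Suc' not0_implies_Suc)
    then show False
    proof cases
      case 1
      have "[] \<in> V" "[0] \<in> V" "tdist [] [0::nat] = 1"
        using zeros_ones(1)[of 0] zeros_ones(1)[of 1] h tdist_eq_1_iff[of "[]" "[0::nat]"] by auto
      then have "([], [0]) \<in> parcs ((metamour ^^ k) T)" by (simp add: 1 arc_complete_tree_iff)
      moreover have "([], [0]) \<notin> parcs ((metamour ^^ (k + 2)) T)"
        unfolding 1 add_0 E2_iff using \<open>tdist [] [0::nat] = 1\<close> by simp
      ultimately show False using eq by (simp only:)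
    next
      case 2
      let ?x = "replicate 4 (0::nat)" and ?y = "replicate 4 (Suc 0)"
      have *: "4 \<le> h" using h by simp
      note z = zeros_ones[OF *]
      have "hop ?x ?y = 2" using z(3) by (intro hop_tdist_8) simp
      then have "(?x, ?y) \<in> parcs ((metamour ^^ (1 + 2)) T)"
        unfolding metamour_arcs using z by simp
      moreover have "(?x, ?y) \<notin> parcs ((metamour ^^ 1) T)"
        using z(3) by (simp add: metamour_arc_iff_tdist)
      ultimately show False using eq unfolding 2 by (simp only: simp_thms)
    next
      case (3 k')
      define n :: nat where "n = 2 ^ k + 1"
      have n: "n = 4 * 2 ^ k' + 1" "n \<le> h" using hk by (simp_all add: n_def 3)
      have "(1::nat) \<le> 2 ^ k'" by simp
      note z = zeros_ones[OF n(2)]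
      let ?x = "replicate n (0::nat)" and ?y = "replicate n (Suc 0)"
      have "hop ?x ?y = 2 * 2 ^ k' + 1"
        using z(3) n(1) \<open>1 \<le> 2 ^ k'\<close> by (subst hop_eq) (auto simp: exceptional_def)
      moreover have "ceillog2 (2 * 2 ^ k' + 1) = k' + 2"
        using \<open>1 \<le> 2 ^ k'\<close> by (intro ceillog2_eqI) auto
      ultimately have c: "ceillog2 (hop ?x ?y) = k' + 2" by simp
      have "(?x, ?y) \<in> parcs ((metamour ^^ ((k' + 2) + 2)) T)"
        unfolding metamour_arcs c using z n(1) by simp
      moreover have "(?x, ?y) \<notin> parcs ((metamour ^^ (k' + 2)) T)"
        unfolding metamour_arcs c by simp
      ultimately show False using eq unfolding 3 by (simp only: simp_thms)
    qed
  qed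
qed

text \<open>
  Pairs at tree distance 4 have level 0, so from index 2 on they are adjacent at even indices
  only.
\<close>

lemma consecutive_distinct:
  assumes "h \<le> 2 ^ k"
  shows "(metamour ^^ k) T \<noteq> (metamour ^^ (k + 1)) T"
proof -
  have le2: "h \<le> 2 ^ (k + 1)" using assms by simp
  have "2 \<le> h" using h by simp
  note z = zeros_ones[OF this]
  let ?x = "replicate 2 (0::nat)" and ?y = "replicate 2 (Suc 0)"
  have "hop ?x ?y = 1" using z(3) by (subst hop_eq_1_iff) simp_all
  then have c: "ceillog2 (hop ?x ?y) = 0" by simp
  have "(?x, ?y) \<in> parcs ((metamour ^^ k) T) \<longleftrightarrow> even k"
    unfolding late_arcs[OF assms] c using z by simp
  moreover have "(?x, ?y) \<in> parcs ((metamour ^^ (k + 1)) T) \<longleftrightarrow> odd k"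
    unfolding late_arcs[OF le2] c using z by simp
  ultimately show ?thesis by (metis (no_types))
qed

lemma periodic_from_2_iff: "metamour_periodic_from T 2 N \<longleftrightarrow> h \<le> 2 ^ N"
proof
  assume "metamour_periodic_from T 2 N"
  then have "(metamour ^^ N) T = (metamour ^^ (N + 2)) T"
    unfolding metamour_periodic_from_def by (metis add.commute order_refl)
  then show "h \<le> 2 ^ N" by (simp only: periodic_step_iff)
next
  assume le: "h \<le> 2 ^ N"
  have "h \<le> 2 ^ i" if "N \<le> i" for i
    using order_trans[OF le power_increasing[OF that]] by simp
  then show "metamour_periodic_from T 2 N"
    unfolding metamour_periodic_from_def
    using periodic_step_iff[THEN iffD2] by (metis add.commute)
qed

lemma limit_period_iff: "has_metamour_limit_period T k \<longleftrightarrow> k = 2"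
proof -
  have two: "metamour_periodic_from T 2 h" unfolding periodic_from_2_iff by (simp add: less_imp_le)
  have one: "\<not> metamour_periodic_from T 1 N" for N
  proof
    assume "metamour_periodic_from T 1 N"
    then have "(metamour ^^ max N h) T = (metamour ^^ (max N h + 1)) T"
      unfolding metamour_periodic_from_def by (metis add.commute max.cobounded1)
    moreover have "h \<le> 2 ^ max N h"
      by (metis less_exp less_imp_le max.cobounded2 order_trans)
    ultimately show False using consecutive_distinct by blast
  qed
  show ?thesis
  proof
    assume *: "has_metamour_limit_period T k"
    then have "k > 0" "k \<noteq> 1" using one by (auto simp: has_metamour_limit_period_def)
    moreover have "\<not> 2 < k" using * two unfolding has_metamour_limit_period_def by (metis pos2)
    ultimately show "k = 2" by simp
  next
    assume "k = 2"
    then show "has_metamour_limit_period T k"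
      unfolding has_metamour_limit_period_def using two one
      by (metis One_nat_def less_2_cases less_numeral_extra(3) pos2)
  qed
qed

lemma limit_set_eq: "metamour_limit_set T = {(metamour ^^ i) T | i. h \<le> 2 ^ i}"
proof -
  have "(\<exists>N. h \<le> 2 ^ N \<and> N \<le> i) \<longleftrightarrow> h \<le> 2 ^ i" for i
    using power_increasing[of _ i "2::nat"] by (auto intro: order_trans)
  then show ?thesis
    unfolding metamour_limit_set_def limit_period_iff by (auto simp: periodic_from_2_iff)
qed

lemma limit_set_eq_pair:
  assumes "h \<le> 2 ^ k"
  shows "metamour_limit_set T = {(metamour ^^ k) T, (metamour ^^ (k + 1)) T}"
proof -
  define N where "N = ceillog2 h"
  have N: "h \<le> 2 ^ i \<longleftrightarrow> N \<le> i" for i using h by (simp add: N_def ceillog2_le_iff)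
  have step: "(metamour ^^ (i + 2)) T = (metamour ^^ i) T" if "N \<le> i" for i
    using that unfolding N[symmetric] by (rule periodic_step_iff[THEN iffD2, symmetric])
  have "(metamour ^^ i) T = (metamour ^^ k) T \<or> (metamour ^^ i) T = (metamour ^^ (k + 1)) T"
    if "N \<le> i" for i
  proof -
    have "N \<le> k" "N \<le> k + 1" "even (i + k) \<or> even (i + (k + 1))" using assms N by auto
    then show ?thesis
      using two_step_periodic[of N "\<lambda>i. (metamour ^^ i) T", OF step that] by blast
  qed
  moreover have "N \<le> k" "N \<le> k + 1" using assms N by auto
  ultimately show ?thesis unfolding limit_set_eq N by blast
qed

lemma depth_eq_1_iff: "x \<in> V \<Longrightarrow> depth T x = 1 \<longleftrightarrow> length x = 1"
proof -
  assume x: "x \<in> V"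
  have root: "[] \<in> V" by (simp add: words_def)
  have "depth T x = 1 \<longleftrightarrow> at_dist (parcs T) 1 [] x"
    using gdist_eq_iff_at_dist[OF pair_graph_complete_tree, of "[]" h m x 1] root
    by (simp add: depth_def one_ereal_def)
  also have "\<dots> \<longleftrightarrow> tdist [] x = 1"
    unfolding at_dist_1_iff arc_complete_tree_iff using x root by auto
  also have "tdist [] x = length x" by (simp add: tdist_def)
  finally show ?thesis .
qed

lemma gdist_E2:
  assumes "x \<in> V" "y \<in> V"
  shows "gdist ((metamour ^^ 2) T) x y = (if even (tdist x y) then ereal (real (hop x y)) else \<infinity>)"
proof -
  have G: "pair_graph ((metamour ^^ 2) T)"
    by (intro pair_graph_metamour_funpow pair_graph_complete_tree)
  have x: "x \<in> pverts ((metamour ^^ 2) T)"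
    unfolding pverts_metamour_funpow using assms(1) by simp
  show ?thesis
    using gdist_eq_of_at_dist[OF G x, of "hop x y" y] gdist_eq_infinity[OF G x, of y]
      at_dist_E2_iff[OF assms(1)] assms(2) by presburger
qed

lemma edge_criterion:
  assumes "h \<le> 2 ^ k" "x \<in> V" "y \<in> V" "x \<noteq> y" "\<not> top_pair x y"
  shows "(x, y) \<in> parcs ((metamour ^^ k) T) \<longleftrightarrow>
    gdist ((metamour ^^ 2) T) x y \<noteq> \<infinity> \<and>
    [\<lceil>log 2 (real_of_ereal (gdist ((metamour ^^ 2) T) x y))\<rceil> = int k] (mod 2)"
proof (cases "even (tdist x y)")
  case True
  then have "hop x y > 0" using hop_eq_0_iff[of x y] assms(4) by simp
  moreover have parity: "[int c = int k] (mod 2) \<longleftrightarrow> even (c + k)" for c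
    by (auto simp: cong_def mod2_eq_if)
  ultimately show ?thesis
    unfolding gdist_E2[OF assms(2,3)] late_arcs[OF assms(1)]
    using True assms(2-5) ceiling_log2_eq_ceillog2[of "hop x y"]
    by (simp add: parity del: even_add)
next
  case False
  then show ?thesis unfolding gdist_E2[OF assms(2,3)] late_arcs[OF assms(1)] by simp
qed

end

theorem theorem9p8:
  fixes h m :: nat and T :: "nat list pair_pre_digraph"
  assumes "m \<ge> 2" and "h \<ge> 5"
    and "T = complete_tree h m"
  shows
    "(\<forall>k::nat. (metamour ^^ k) T = (metamour ^^ (k + 2)) T \<longleftrightarrow> int k \<ge> \<lceil>log 2 (real h)\<rceil>)
     \<and> has_metamour_limit_period T 2
     \<and> (\<forall>k::nat. int k \<ge> \<lceil>log 2 (real h)\<rceil> \<longrightarrow>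
          metamour_limit_set T = {(metamour ^^ k) T, (metamour ^^ (k + 1)) T}
          \<and> (metamour ^^ k) T \<noteq> (metamour ^^ (k + 1)) T)
     \<and> (\<forall>x\<in>pverts T. \<forall>y\<in>pverts T. x \<noteq> y \<longrightarrow>
          (if depth T x = 1 \<and> depth T y = 1 \<and> m = 2 \<and> h \<in> {5, 6}
           then \<forall>G\<in>metamour_limit_set T. (x, y) \<notin> parcs G
           else \<forall>k::nat. int k \<ge> \<lceil>log 2 (real h)\<rceil> \<longrightarrow>
             ((x, y) \<in> parcs ((metamour ^^ k) T) \<longleftrightarrow>
              gdist ((metamour ^^ 2) T) x y \<noteq> \<infinity>
              \<and> [\<lceil>log 2 (real_of_ereal (gdist ((metamour ^^ 2) T) x y))\<rceil> = int k] (mod 2))))"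
proof -
  interpret tall_tree h m using assms(1,2) by unfold_locales
  have late: "int k \<ge> \<lceil>log 2 (real h)\<rceil> \<longleftrightarrow> h \<le> 2 ^ k" for k
    using assms(2) by (simp add: ceiling_log2_le_iff)
  have top: "depth T x = 1 \<and> depth T y = 1 \<and> m = 2 \<and> h \<in> {5, 6} \<longleftrightarrow> top_pair x y"
    if "x \<in> pverts T" "y \<in> pverts T" "x \<noteq> y" for x y
    using that assms(2) depth_eq_1_iff[of x] depth_eq_1_iff[of y]
    unfolding top_pair_def assms(3) pverts_complete_tree by auto
  have no_arc: "(x, y) \<notin> parcs G" if "top_pair x y" "G \<in> metamour_limit_set T" for x y G
    using that late_arcs unfolding assms(3) limit_set_eq by auto
  have criterion: "(x, y) \<in> parcs ((metamour ^^ k) T) \<longleftrightarrow>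
      gdist ((metamour ^^ 2) T) x y \<noteq> \<infinity> \<and>
      [\<lceil>log 2 (real_of_ereal (gdist ((metamour ^^ 2) T) x y))\<rceil> = int k] (mod 2)"
    if "x \<in> pverts T" "y \<in> pverts T" "x \<noteq> y" "\<not> top_pair x y" "h \<le> 2 ^ k" for x y k
    using edge_criterion[of k x y] that unfolding assms(3) pverts_complete_tree by blast
  show ?thesis
  proof (intro conjI allI ballI impI, unfold late)
    show "(metamour ^^ k) T = (metamour ^^ (k + 2)) T \<longleftrightarrow> h \<le> 2 ^ k" for k
      unfolding assms(3) by (rule periodic_step_iff)
    show "has_metamour_limit_period T 2"
      unfolding assms(3) limit_period_iff by (rule refl)
    show "metamour_limit_set T = {(metamour ^^ k) T, (metamour ^^ (k + 1)) T}" if "h \<le> 2 ^ k" for k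
      unfolding assms(3) using that by (rule limit_set_eq_pair)
    show "(metamour ^^ k) T \<noteq> (metamour ^^ (k + 1)) T" if "h \<le> 2 ^ k" for k
      unfolding assms(3) using that by (rule consecutive_distinct)
    fix x y assume xy: "x \<in> pverts T" "y \<in> pverts T" "x \<noteq> y"
    show "if depth T x = 1 \<and> depth T y = 1 \<and> m = 2 \<and> h \<in> {5, 6}
        then \<forall>G\<in>metamour_limit_set T. (x, y) \<notin> parcs G
        else \<forall>k. h \<le> 2 ^ k \<longrightarrow> ((x, y) \<in> parcs ((metamour ^^ k) T) \<longleftrightarrow>
          gdist ((metamour ^^ 2) T) x y \<noteq> \<infinity> \<and>
          [\<lceil>log 2 (real_of_ereal (gdist ((metamour ^^ 2) T) x y))\<rceil> = int k] (mod 2))"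
      unfolding top[OF xy] using no_arc criterion[OF xy] by (simp only: split: if_split) blast
  qed
qed

end
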